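(* Let $m,n\ge0$ be integers, let $x_1,\dots,x_m\in\mathbb{R}\times\Pi$ and $y_1,\dots,y_n\in\Pi\times\mathbb{R}$, and let $\xi\in\mathbb{R}$, $\beta_1,\dots,\beta_m>0$, $\gamma_1,\dots,\gamma_n>0$. Consider the problem of determining whether there exists a function $h\in\mathcal{P}_2$ that satisfies, for $j=1,\dots,m$ and $k=1,\dots,n$, (1) $x_j$ and $y_k$ are $B$-points for $h$; (2) $h(x_j)=\xi=h(y_k)$; and (3) $\nabla h(x_j)=\begin{pmatrix}\beta_j\\0\end{pmatrix}$ and $\nabla h(y_k)=\begin{pmatrix}0\\\gamma_k\end{pmatrix}$, and of describing the set of all such functions $h$ when they exist. This problem always has infinitely many solutions. The solution set consists of all functions $h$ expressible in the form $$h(z)=\xi+\frac{1}{r(z)-f(z)}\quad\text{for all }z\in\Pi^2$$ for some $f\in\mathcal{P}_2$ such that $$\lim_{t\to0+}t f(x_j+\mathrm{i}te_1)=0=\lim_{t\to0+}t f(y_k+\mathrm{i}te_2),\qquad 1\le j\le m,\ 1\le k\le n,$$ where $$r(z)=\sum_{j=1}^m\frac{1}{\beta_j(z^1-x_j^1)}+\sum_{k=1}^n\frac{1}{\gamma_k(z^2-y_k^2)}.$$ In particular, the function $h=\xi+1/(r-c)$ is a solution of the problem for any $c\in\mathbb{R}$.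
   Context: $\Pi=\{z\in\mathbb{C}:\mathrm{Im}\,z>0\}$. Superscripts on points of $\mathbb{C}^2$ are coordinate indices: $z=(z^1,z^2)$, $x_j=(x_j^1,x_j^2)$, $y_k=(y_k^1,y_k^2)$; $\|z\|=\max\{|z^1|,|z^2|\}$; $e_1=(1,0)$, $e_2=(0,1)$. Empty sums are $0$. The two-variable Pick class $\mathcal{P}_2$ is the set of analytic functions on $\Pi^2$ with non-negative imaginary part. A set $S\subset\Pi^2$ approaches $x\in\partial(\Pi^2)$ nontangentially if $x$ lies in the closure of $S$ and $\|z-x\|/\mathrm{dist}(z,\mathbb{C}^2\setminus\Pi^2)$ is bounded for $z\in S$. A nontangential limit at $x$ is a limit that exists, with the same value, along every set approaching $x$ nontangentially. A point $x\in\partial(\Pi^2)\subset\mathbb{C}^2$ is a $B$-point for $h\in\mathcal{P}_2$ if $\liminf_{z\to x}\frac{\mathrm{Im}\,h(z)}{\mathrm{Im}\,z^j}<\infty$ for $j=1,2$ ($z$ ranging over $\Pi^2$). The value $h(x)$ at a $B$-point $x$ denotes the nontangential limit of $h$ at $x$. A point $x\in\partial(\Pi^2)$ is a $C$-point for $h$ if for every set $S\subset\Pi^2$ approaching $x$ nontangentially there are $\omega\in\mathbb{R}$ and $\eta^1,\eta^2\in\mathbb{C}$ such that $h(z)=\omega+\eta^1(z^1-x^1)+\eta^2(z^2-x^2)+o(\|z-x\|)$ as $z\to x$ in $S$. These quantities are then the same for every such $S$, and the angular gradient is $\nabla h(x)=\begin{pmatrix}\eta^1\\\eta^2\end{pmatrix}$.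 (Every $B$-point of $h$ in $\mathbb{R}\times\Pi$ or $\Pi\times\mathbb{R}$ is a $C$-point of $h$, so $\nabla h$ is defined there.)
   Formalization: The first coordinates x_j^1 are assumed pairwise distinct, and likewise the second coordinates y_k^2 (with a repetition the claim fails: the masses add); for m=n=0 the undefined 1/(r-f) with f=0 is read as 0, giving the solution h=ξ. *)

theory Defs
  imports "HOL-Analysis.Analysis" "HOL-Library.Landau_Symbols" "HOL-Library.FuncSet"
begin

definition UHP :: "complex set" where
  "UHP = {z. Im z > 0}"

definition UHP2 :: "(complex \<times> complex) set" where
  "UHP2 = UHP \<times> UHP"

text \<open>The library norm on \<open>complex \<times> complex\<close> is Euclidean, so the maximum norm, and the distance
  it induces, are introduced separately.\<close>

definition maxnorm :: "complex \<times> complex \<Rightarrow> real" where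
  "maxnorm z = max (cmod (fst z)) (cmod (snd z))"

definition dist_compl :: "complex \<times> complex \<Rightarrow> real" where
  "dist_compl z = (INF w\<in>- UHP2. maxnorm (z - w))"

text \<open>Analyticity on an open subset of \<open>complex \<times> complex\<close>: Frechet differentiability with
  complex-linear derivative at every point.\<close>

definition analytic2_on :: "(complex \<times> complex \<Rightarrow> complex) \<Rightarrow> (complex \<times> complex) set \<Rightarrow> bool" where
  "analytic2_on f U \<longleftrightarrow>
     (\<forall>z\<in>U. \<exists>a b. (f has_derivative (\<lambda>v. a * fst v + b * snd v)) (at z))"

text \<open>Elements of the Pick class are functions on \<^term>\<open>UHP2\<close>. Requiring them to be extensional
  identifies functions that agree on \<^term>\<open>UHP2\<close>; in particular, infinitely many members
  means infinitely many different functions on \<^term>\<open>UHP2\<close>.\<close>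

definition pick2 :: "(complex \<times> complex \<Rightarrow> complex) set" where
  "pick2 = {h \<in> extensional UHP2. analytic2_on h UHP2 \<and> (\<forall>z\<in>UHP2. Im (h z) \<ge> 0)}"

definition approaches_nt :: "(complex \<times> complex) set \<Rightarrow> complex \<times> complex \<Rightarrow> bool" where
  "approaches_nt S x \<longleftrightarrow> S \<subseteq> UHP2 \<and> x \<in> frontier UHP2 \<and> x \<in> closure S \<and>
     (\<exists>K. \<forall>z\<in>S. maxnorm (z - x) / dist_compl z \<le> K)"

definition has_nt_limit ::
  "(complex \<times> complex \<Rightarrow> complex) \<Rightarrow> complex \<times> complex \<Rightarrow> complex \<Rightarrow> bool" where
  "has_nt_limit h x l \<longleftrightarrow> (\<forall>S. approaches_nt S x \<longrightarrow> (h \<longlongrightarrow> l) (at x within S))"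

definition B_point :: "(complex \<times> complex \<Rightarrow> complex) \<Rightarrow> complex \<times> complex \<Rightarrow> bool" where
  "B_point h x \<longleftrightarrow> x \<in> frontier UHP2 \<and>
     Liminf (at x within UHP2) (\<lambda>z. ereal (Im (h z) / Im (fst z))) < \<infinity> \<and>
     Liminf (at x within UHP2) (\<lambda>z. ereal (Im (h z) / Im (snd z))) < \<infinity>"

definition linear_expansion ::
  "(complex \<times> complex \<Rightarrow> complex) \<Rightarrow> complex \<times> complex \<Rightarrow> (complex \<times> complex) set \<Rightarrow>
   real \<Rightarrow> complex \<times> complex \<Rightarrow> bool" where
  "linear_expansion h x S \<omega> \<eta> \<longleftrightarrow>
     (\<lambda>z. h z - (of_real \<omega> + fst \<eta> * (fst z - fst x) + snd \<eta> * (snd z - snd x)))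
       \<in> o[at x within S](\<lambda>z. of_real (maxnorm (z - x)))"

definition C_point :: "(complex \<times> complex \<Rightarrow> complex) \<Rightarrow> complex \<times> complex \<Rightarrow> bool" where
  "C_point h x \<longleftrightarrow> x \<in> frontier UHP2 \<and>
     (\<forall>S. approaches_nt S x \<longrightarrow> (\<exists>\<omega> \<eta>. linear_expansion h x S \<omega> \<eta>))"

text \<open>The angular gradient is the \<open>\<eta>\<close> that serves for all nontangential sets simultaneously. A single
  thin set, such as a ray, does not determine \<open>\<eta>\<close>.\<close>

definition has_angular_gradient ::
  "(complex \<times> complex \<Rightarrow> complex) \<Rightarrow> complex \<times> complex \<Rightarrow> complex \<times> complex \<Rightarrow> bool" where
  "has_angular_gradient h x \<eta> \<longleftrightarrow> C_point h x \<and>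
     (\<exists>\<omega>. \<forall>S. approaches_nt S x \<longrightarrow> linear_expansion h x S \<omega> \<eta>)"

definition solutions ::
  "nat \<Rightarrow> nat \<Rightarrow> (nat \<Rightarrow> complex \<times> complex) \<Rightarrow> (nat \<Rightarrow> complex \<times> complex) \<Rightarrow>
   real \<Rightarrow> (nat \<Rightarrow> real) \<Rightarrow> (nat \<Rightarrow> real) \<Rightarrow> (complex \<times> complex \<Rightarrow> complex) set" where
  "solutions m n x y \<xi> \<beta> \<gamma> = {h \<in> pick2.
     (\<forall>j\<in>{1..m}. B_point h (x j) \<and> has_nt_limit h (x j) (of_real \<xi>) \<and>
        has_angular_gradient h (x j) (of_real (\<beta> j), 0)) \<and>
     (\<forall>k\<in>{1..n}. B_point h (y k) \<and> has_nt_limit h (y k) (of_real \<xi>) \<and>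
        has_angular_gradient h (y k) (0, of_real (\<gamma> k)))}"

text \<open>If \<open>m + n > 0\<close>, then \<open>Im (rfun \<dots> z) < 0\<close> on \<^term>\<open>UHP2\<close>, so \<open>rfun \<dots> z - f z\<close> does not
  vanish for \<open>f\<close> in the Pick class. If \<open>m = n = 0\<close> and \<open>f = 0\<close>, the convention \<open>1 / 0 = 0\<close> makes
  \<open>\<xi> + 1 / (rfun \<dots> z - f z)\<close> the constant function \<open>\<xi>\<close>.\<close>

definition rfun ::
  "nat \<Rightarrow> nat \<Rightarrow> (nat \<Rightarrow> complex \<times> complex) \<Rightarrow> (nat \<Rightarrow> complex \<times> complex) \<Rightarrow>
   (nat \<Rightarrow> real) \<Rightarrow> (nat \<Rightarrow> real) \<Rightarrow> complex \<times> complex \<Rightarrow> complex" where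
  "rfun m n x y \<beta> \<gamma> z =
     (\<Sum>j=1..m. 1 / (of_real (\<beta> j) * (fst z - fst (x j)))) +
     (\<Sum>k=1..n. 1 / (of_real (\<gamma> k) * (snd z - snd (y k))))"

end

theory Submission
  imports Defs "HOL-Complex_Analysis.Great_Picard"
begin

text \<open>Put \<open>F = - 1 / (h - \<xi>)\<close>. Up to an additive real constant, which keeps the imaginary part, this is
the involution \<open>u \<mapsto> - 1 / u\<close> of the closed half-plane, so \<open>h\<close> and \<open>F\<close> are Pick functions together.
The three boundary conditions at a point \<open>x = (a, p)\<close> with \<open>a\<close> real become a single condition on \<open>F\<close>:
the first-order expansion \<open>h = \<xi> + \<beta> (z\<^sup>1 - a) + o\<close> says that \<open>F\<close> has the simple-pole behaviour
\<open>- 1 / (\<beta> (z\<^sup>1 - a))\<close> at \<open>x\<close>, that is, \<open>t F (x + i t e\<^sub>1) \<longlonglongrightarrow> i / \<beta>\<close>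
(\<open>facet_data_iff_point_mass\<close>). In terms of the measure that represents the Pick function
\<open>F (\<cdot>, p)\<close>, the point \<open>a\<close> carries mass \<open>1 / \<beta>\<close>. The function \<open>- r\<close> is the Pick function with
exactly the prescribed masses, and the theorem says that a Pick function has these masses iff it is
\<open>- r\<close> plus a Pick function \<open>f\<close> without mass at the given points; solving \<open>F = f - r\<close> for \<open>h\<close> gives
\<open>h = \<xi> + 1 / (r - f)\<close>.

The substance is that subtracting \<open>- c / (z\<^sup>1 - a)\<close>, where \<open>c\<close> is the mass at \<open>a\<close> in \<^emph>\<open>one\<close> slice
\<open>z\<^sup>2 = p\<close>, leaves a Pick function of two variables (\<open>pickfun_remove_mass\<close>). In one variable this
is Julia's inequality, the boundary case of the Schwarz--Pick lemma (\<open>julia_inequality\<close>). It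
applies in every other slice because the mass at \<open>a\<close> does not depend on the slice: as a function of
\<open>z\<^sup>2\<close> it is a limit of holomorphic functions, and it is real, hence constant
(\<open>point_mass_indep\<close>). The same reality of the mass is again a consequence of Julia's inequality.

Only radial limits enter the mass, while the boundary conditions on \<open>h\<close> are nontangential. The
passage between them is Harnack's inequality for Pick functions (\<open>harnack_inequality\<close>): points at
bounded hyperbolic distance have comparable values, so after removal of the mass, the radial
estimate for the massless remainder spreads to whole approach regions.\<close>

section \<open>The Schwarz--Pick lemma and Julia's inequality\<close>

lemma open_UHP: "open UHP"
  unfolding UHP_def by (rule open_halfspace_Im_gt)

text \<open>The cross term turns the contraction of the pseudo-hyperbolic distance
\<open>|u - v| / |u - cnj v|\<close> into an inequality between products of imaginary parts.\<close>

lemma cmod_sub_cnj: "(cmod (u - cnj v))\<^sup>2 = (cmod (u - v))\<^sup>2 + 4 * Im u * Im v"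
  unfolding cmod_power2 by (simp add: power2_eq_square algebra_simps)

lemma cmod_sub_less_cnj:
  assumes "Im u > 0" "Im v > 0"
  shows "cmod (u - v) < cmod (u - cnj v)"
proof -
  have "(cmod (u - v))\<^sup>2 < (cmod (u - cnj v))\<^sup>2"
    unfolding cmod_sub_cnj using assms by simp
  then show ?thesis by (rule power_less_imp_less_base) simp
qed

text \<open>Conjugating by Cayley transforms that send \<open>w\<close> and \<open>\<phi> w\<close> to \<open>0\<close> reduces this to
Schwarz's lemma. The inequality is stated without denominators so that it survives limits.\<close>

lemma schwarz_pick_strict:
  assumes hol: "\<phi> holomorphic_on UHP" and pos: "\<And>z. z \<in> UHP \<Longrightarrow> Im (\<phi> z) > 0"
    and z: "z \<in> UHP" and w: "w \<in> UHP"
  shows "Im z * Im w * (cmod (\<phi> z - cnj (\<phi> w)))\<^sup>2 \<le> Im (\<phi> z) * Im (\<phi> w) * (cmod (z - cnj w))\<^sup>2"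
proof -
  \<comment> \<open>\<open>T\<close> maps the unit disc to the half-plane with \<open>T 0 = w\<close>, and \<open>T \<zeta>0 = z\<close>.\<close>
  define T where "T = (\<lambda>\<zeta>. (w - cnj w * \<zeta>) / (1 - \<zeta>))"
  define p where "p = \<phi> w"
  define F where "F = (\<lambda>\<zeta>. (\<phi> (T \<zeta>) - p) / (\<phi> (T \<zeta>) - cnj p))"
  define \<zeta>0 where "\<zeta>0 = (z - w) / (z - cnj w)"
  have ImT: "T \<zeta> \<in> UHP" if "cmod \<zeta> < 1" for \<zeta>
  proof -
    have "\<zeta> \<noteq> 1" using that by auto
    then have d: "(Re (1 - \<zeta>))\<^sup>2 + (Im (1 - \<zeta>))\<^sup>2 > 0"
      by (metis cmod_power2 right_minus_eq zero_less_norm_iff zero_less_power)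
    have "(cmod \<zeta>)\<^sup>2 < 1" using that by (simp add: power_less_one_iff)
    then have n: "Im w * (1 - (cmod \<zeta>)\<^sup>2) > 0" using w by (simp add: UHP_def)
    have "Im (T \<zeta>) = Im w * (1 - (cmod \<zeta>)\<^sup>2) / ((Re (1 - \<zeta>))\<^sup>2 + (Im (1 - \<zeta>))\<^sup>2)"
      unfolding T_def Im_divide cmod_power2
      by (rule arg_cong2[where f="(/)"]) (simp_all add: power2_eq_square algebra_simps)
    then show ?thesis using n d by (simp add: UHP_def)
  qed
  have wp: "Im p > 0" using pos w by (simp add: p_def)
  have den: "\<phi> (T \<zeta>) - cnj p \<noteq> 0" if "cmod \<zeta> < 1" for \<zeta>
    using cmod_sub_less_cnj[OF pos[OF ImT[OF that]] wp] by auto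
  have holT: "T holomorphic_on ball 0 1"
    unfolding T_def by (intro holomorphic_intros) auto
  have "(\<phi> \<circ> T) holomorphic_on ball 0 1"
    using holT hol ImT by (intro holomorphic_on_compose_gen[of _ _ _ UHP]) auto
  then have holF: "F holomorphic_on ball 0 1"
    unfolding F_def o_def using den by (intro holomorphic_intros) auto
  have F0: "F 0 = 0" by (simp add: F_def T_def p_def)
  have F1: "cmod (F \<zeta>) < 1" if "cmod \<zeta> < 1" for \<zeta>
    using cmod_sub_less_cnj[OF pos[OF ImT[OF that]] wp] den[OF that]
    by (simp add: F_def norm_divide)
  have zw: "cmod (z - w) < cmod (z - cnj w)"
    using z w by (intro cmod_sub_less_cnj) (auto simp: UHP_def)
  then have nz: "z - cnj w \<noteq> 0" by auto
  have \<zeta>0: "cmod \<zeta>0 < 1" using zw nz by (simp add: \<zeta>0_def norm_divide)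
  have "w \<noteq> cnj w" using w by (auto simp: UHP_def complex_eq_iff)
  have T0: "T \<zeta>0 = z"
  proof -
    have "1 - \<zeta>0 = (w - cnj w) / (z - cnj w)" using nz by (simp add: \<zeta>0_def divide_simps)
    moreover have "w - cnj w * \<zeta>0 = z * (w - cnj w) / (z - cnj w)"
      using nz by (simp add: \<zeta>0_def divide_simps) (simp add: algebra_simps)
    ultimately show ?thesis using nz \<open>w \<noteq> cnj w\<close> by (simp add: T_def)
  qed
  have "cmod (F \<zeta>0) \<le> cmod \<zeta>0"
    by (rule Schwarz_Lemma(1)[OF holF F0 F1 \<zeta>0])
  then have "cmod (\<phi> z - p) * cmod (z - cnj w) \<le> cmod (z - w) * cmod (\<phi> z - cnj p)"
    using nz den[OF \<zeta>0] unfolding F_def T0 by (simp add: \<zeta>0_def norm_divide divide_simps)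
  then have "(cmod (\<phi> z - p))\<^sup>2 * (cmod (z - cnj w))\<^sup>2 \<le> (cmod (z - w))\<^sup>2 * (cmod (\<phi> z - cnj p))\<^sup>2"
    by (metis mult_nonneg_nonneg norm_ge_zero power_mono power_mult_distrib)
  then show ?thesis
    unfolding p_def cmod_sub_cnj by (simp add: algebra_simps)
qed

text \<open>The closed half-plane is reached by adding \<open>i \<epsilon>\<close> and letting \<open>\<epsilon>\<close> tend to \<open>0\<close>; this avoids treating
real constants separately.\<close>

lemma schwarz_pick:
  assumes hol: "\<phi> holomorphic_on UHP" and pos: "\<And>z. z \<in> UHP \<Longrightarrow> Im (\<phi> z) \<ge> 0"
    and z: "z \<in> UHP" and w: "w \<in> UHP"
  shows "Im z * Im w * (cmod (\<phi> z - cnj (\<phi> w)))\<^sup>2 \<le> Im (\<phi> z) * Im (\<phi> w) * (cmod (z - cnj w))\<^sup>2"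
proof -
  define \<psi> where "\<psi> = (\<lambda>(\<epsilon>::real) z. \<phi> z + \<i> * of_real \<epsilon>)"
  have le: "Im z * Im w * (cmod (\<psi> \<epsilon> z - cnj (\<psi> \<epsilon> w)))\<^sup>2 \<le> Im (\<psi> \<epsilon> z) * Im (\<psi> \<epsilon> w) * (cmod (z - cnj w))\<^sup>2"
    if "\<epsilon> > 0" for \<epsilon>
    by (rule schwarz_pick_strict[OF _ _ z w])
       (auto simp: \<psi>_def that add_nonneg_pos pos intro!: holomorphic_intros hol)
  have lim: "((\<lambda>\<epsilon>. \<psi> \<epsilon> u) \<longlongrightarrow> \<phi> u) (at_right 0)" for u
    unfolding \<psi>_def by (auto intro!: tendsto_eq_intros)
  show ?thesis
  proof (rule tendsto_le)
    show "((\<lambda>\<epsilon>. Im (\<psi> \<epsilon> z) * Im (\<psi> \<epsilon> w) * (cmod (z - cnj w))\<^sup>2)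
        \<longlongrightarrow> Im (\<phi> z) * Im (\<phi> w) * (cmod (z - cnj w))\<^sup>2) (at_right 0)"
      by (intro tendsto_intros lim)
    show "((\<lambda>\<epsilon>. Im z * Im w * (cmod (\<psi> \<epsilon> z - cnj (\<psi> \<epsilon> w)))\<^sup>2)
        \<longlongrightarrow> Im z * Im w * (cmod (\<phi> z - cnj (\<phi> w)))\<^sup>2) (at_right 0)"
      by (intro tendsto_intros lim)
    show "\<forall>\<^sub>F \<epsilon> in at_right 0. Im z * Im w * (cmod (\<psi> \<epsilon> z - cnj (\<psi> \<epsilon> w)))\<^sup>2
        \<le> Im (\<psi> \<epsilon> z) * Im (\<psi> \<epsilon> w) * (cmod (z - cnj w))\<^sup>2"
      using eventually_at_right_less[of "0::real"] by eventually_elim (rule le)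
  qed simp
qed

text \<open>Since \<open>(|u| - |v|)\<^sup>2 \<le> |u - cnj v|\<^sup>2\<close> and \<open>Im u Im v \<le> |u| |v|\<close>, the Schwarz--Pick inequality bounds the
quantity \<open>(|u| - |v|)\<^sup>2\<close> by \<open>\<kappa> |u| |v|\<close>, where \<open>\<kappa>\<close> is the quotient in the conclusion; drop \<open>|v|\<^sup>2\<close> and
divide by \<open>|u|\<close>. In particular, a Pick function with a zero vanishes
identically.\<close>

lemma harnack_inequality:
  assumes hol: "\<phi> holomorphic_on UHP" and pos: "\<And>z. z \<in> UHP \<Longrightarrow> Im (\<phi> z) \<ge> 0"
    and z: "z \<in> UHP" and w: "w \<in> UHP"
  shows "cmod (\<phi> z) \<le> (2 + (cmod (z - cnj w))\<^sup>2 / (Im z * Im w)) * cmod (\<phi> w)"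
proof -
  define \<kappa> where "\<kappa> = (cmod (z - cnj w))\<^sup>2 / (Im z * Im w)"
  have d: "Im z * Im w > 0" using z w by (simp add: UHP_def)
  have "\<kappa> \<ge> 0" using d by (simp add: \<kappa>_def)
  have "\<bar>cmod (\<phi> z) - cmod (\<phi> w)\<bar> \<le> cmod (\<phi> z - cnj (\<phi> w))"
    using norm_triangle_ineq3[of "\<phi> z" "cnj (\<phi> w)"] by simp
  then have "(cmod (\<phi> z) - cmod (\<phi> w))\<^sup>2 \<le> (cmod (\<phi> z - cnj (\<phi> w)))\<^sup>2"
    by (metis abs_ge_zero power2_abs power_mono)
  also have "\<dots> \<le> \<kappa> * (Im (\<phi> z) * Im (\<phi> w))"
    using schwarz_pick[OF hol pos z w] d
    by (simp add: \<kappa>_def field_simps)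
  also have "\<dots> \<le> \<kappa> * (cmod (\<phi> z) * cmod (\<phi> w))"
    using pos[OF z] pos[OF w] \<open>\<kappa> \<ge> 0\<close> abs_Im_le_cmod[of "\<phi> z"] abs_Im_le_cmod[of "\<phi> w"]
    by (intro mult_left_mono mult_mono) auto
  finally have "cmod (\<phi> z) * cmod (\<phi> z) + (cmod (\<phi> w))\<^sup>2 \<le> (2 + \<kappa>) * cmod (\<phi> w) * cmod (\<phi> z)"
    by (simp add: power2_eq_square algebra_simps)
  then have "cmod (\<phi> z) * cmod (\<phi> z) \<le> (2 + \<kappa>) * cmod (\<phi> w) * cmod (\<phi> z)"
    using zero_le_power2[of "cmod (\<phi> w)"] by linarith
  moreover have "0 \<le> (2 + \<kappa>) * cmod (\<phi> w)" using \<open>\<kappa> \<ge> 0\<close> by simp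
  ultimately show ?thesis
    unfolding \<kappa>_def[symmetric]
    by (cases "\<phi> z = 0") (auto simp: mult_le_cancel_right)
qed

text \<open>Multiply the Schwarz--Pick inequality at \<open>z\<close> and \<open>a + i t\<^sub>n\<close> by \<open>t\<^sub>n\<close> and let \<open>n\<close> tend to infinity.
For \<open>u = i c\<close> with \<open>c > 0\<close> the conclusion says that \<open>\<phi>\<close> dominates the Pick function
\<open>- c / (z - a)\<close> in imaginary part.\<close>

lemma julia_inequality:
  fixes \<phi> :: "complex \<Rightarrow> complex" and u z :: complex and a :: real and t :: "nat \<Rightarrow> real"
  assumes hol: "\<phi> holomorphic_on UHP" and pos: "\<And>z. z \<in> UHP \<Longrightarrow> Im (\<phi> z) \<ge> 0"
    and t0: "\<And>n. t n > 0" and t: "t \<longlonglongrightarrow> 0"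
    and u: "(\<lambda>n. t n * \<phi> (a + \<i> * t n)) \<longlonglongrightarrow> u"
    and z: "z \<in> UHP"
  shows "Im z * (cmod u)\<^sup>2 \<le> Im (\<phi> z) * Im u * (cmod (z - a))\<^sup>2"
proof (rule LIMSEQ_le)
  let ?w = "\<lambda>n. a + \<i> * t n"
  show "(\<lambda>n. Im (\<phi> z) * Im (t n * \<phi> (?w n)) * (cmod (z - cnj (?w n)))\<^sup>2)
      \<longlonglongrightarrow> Im (\<phi> z) * Im u * (cmod (z - a))\<^sup>2"
    by (rule tendsto_eq_intros refl u t | simp)+
  show "(\<lambda>n. Im z * (cmod (t n * \<phi> z - cnj (t n * \<phi> (?w n))))\<^sup>2) \<longlonglongrightarrow> Im z * (cmod u)\<^sup>2"
    by (rule tendsto_eq_intros refl u t | simp)+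
  have "Im z * (cmod (t n * \<phi> z - cnj (t n * \<phi> (?w n))))\<^sup>2
        \<le> Im (\<phi> z) * Im (t n * \<phi> (?w n)) * (cmod (z - cnj (?w n)))\<^sup>2" for n
  proof -
    have w: "?w n \<in> UHP" using t0[of n] by (simp add: UHP_def)
    have "t n * (Im z * t n * (cmod (\<phi> z - cnj (\<phi> (?w n))))\<^sup>2)
        \<le> t n * (Im (\<phi> z) * Im (\<phi> (?w n)) * (cmod (z - cnj (?w n)))\<^sup>2)"
      using schwarz_pick[OF hol pos z w] t0[of n] by (intro mult_left_mono) auto
    moreover have "t n * \<phi> z - cnj (t n * \<phi> (?w n)) = t n * (\<phi> z - cnj (\<phi> (?w n)))"
      by (simp add: algebra_simps)
    then have "(cmod (t n * \<phi> z - cnj (t n * \<phi> (?w n))))\<^sup>2 = (t n)\<^sup>2 * (cmod (\<phi> z - cnj (\<phi> (?w n))))\<^sup>2"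
      by (simp add: norm_mult power_mult_distrib)
    ultimately show ?thesis by (simp add: power2_eq_square algebra_simps)
  qed
  then show "\<exists>N. \<forall>n\<ge>N. Im z * (cmod (t n * \<phi> z - cnj (t n * \<phi> (?w n))))\<^sup>2
        \<le> Im (\<phi> z) * Im (t n * \<phi> (?w n)) * (cmod (z - cnj (?w n)))\<^sup>2" by blast
qed

text \<open>Julia's inequality at the points \<open>a + i t\<^sub>n\<close> themselves gives \<open>|u|\<^sup>2 \<le> (Im u)\<^sup>2\<close> in the limit.\<close>

lemma residue_imaginary:
  fixes \<phi> :: "complex \<Rightarrow> complex" and a :: real and t :: "nat \<Rightarrow> real"
  assumes hol: "\<phi> holomorphic_on UHP" and pos: "\<And>z. z \<in> UHP \<Longrightarrow> Im (\<phi> z) \<ge> 0"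
    and t0: "\<And>n. t n > 0" and t: "t \<longlonglongrightarrow> 0"
    and u: "(\<lambda>n. t n * \<phi> (a + \<i> * t n)) \<longlonglongrightarrow> u"
  shows "Re u = 0"
proof -
  have "(cmod u)\<^sup>2 \<le> Im (t n * \<phi> (a + \<i> * t n)) * Im u" for n
  proof -
    have "a + \<i> * t n \<in> UHP" using t0[of n] by (simp add: UHP_def)
    from julia_inequality[OF hol pos t0 t u this]
    have "t n * (cmod u)\<^sup>2 \<le> t n * (Im (t n * \<phi> (a + \<i> * t n)) * Im u)"
      using t0[of n] by (simp add: norm_mult power2_eq_square algebra_simps)
    then show ?thesis using t0[of n] by (simp add: mult_le_cancel_left)
  qed
  moreover have "(\<lambda>n. Im (t n * \<phi> (a + \<i> * t n)) * Im u) \<longlonglongrightarrow> Im u * Im u"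
    by (intro tendsto_intros u)
  ultimately have "(cmod u)\<^sup>2 \<le> Im u * Im u"
    by (intro LIMSEQ_le_const) auto
  then have "(Re u)\<^sup>2 \<le> 0" unfolding cmod_power2 by (simp add: power2_eq_square)
  then show ?thesis by simp
qed

section \<open>Pick functions of two variables\<close>

text \<open>Membership in \<^const>\<open>pick2\<close> without the normalisation of values off \<^const>\<open>UHP2\<close>, so that sums
and reciprocals can be written as plain lambda terms.\<close>

definition pickfun :: "(complex \<times> complex \<Rightarrow> complex) \<Rightarrow> bool" where
  "pickfun F \<longleftrightarrow> analytic2_on F UHP2 \<and> (\<forall>z\<in>UHP2. Im (F z) \<ge> 0)"

lemma open_UHP2: "open UHP2"
  unfolding UHP2_def by (intro open_Times open_UHP)

lemma Pair_in_UHP2 [simp]: "(z, w) \<in> UHP2 \<longleftrightarrow> Im z > 0 \<and> Im w > 0"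
  by (simp add: UHP2_def UHP_def)

lemma UHP2_D: "z \<in> UHP2 \<Longrightarrow> Im (fst z) > 0" "z \<in> UHP2 \<Longrightarrow> Im (snd z) > 0"
  by (cases z; simp)+

lemma pickfun_Im: "pickfun F \<Longrightarrow> z \<in> UHP2 \<Longrightarrow> Im (F z) \<ge> 0"
  by (simp add: pickfun_def)

lemma pickfun_deriv:
  assumes "pickfun F" "z \<in> UHP2"
  obtains a b where "(F has_derivative (\<lambda>v. a * fst v + b * snd v)) (at z)"
  using assms unfolding pickfun_def analytic2_on_def by blast

lemma pickfun_slice_fst:
  assumes F: "pickfun F" and w: "w \<in> UHP"
  shows "(\<lambda>z. F (z, w)) holomorphic_on UHP"
proof (rule holomorphic_onI)
  fix z assume "z \<in> UHP"
  with w have "(z, w) \<in> UHP2" by (simp add: UHP_def)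
  from pickfun_deriv[OF F this] obtain a b
    where F': "(F has_derivative (\<lambda>v. a * fst v + b * snd v)) (at (z, w))" .
  have "((\<lambda>z. (z, w)) has_derivative (\<lambda>v. (v, 0))) (at z within UHP)"
    by (auto intro!: derivative_eq_intros)
  from has_derivative_compose[OF this F']
  have "((\<lambda>z. F (z, w)) has_derivative (*) a) (at z within UHP)" by simp
  then show "(\<lambda>z. F (z, w)) field_differentiable at z within UHP"
    by (auto simp: field_differentiable_def has_field_derivative_def)
qed

lemma analytic2_comp:
  assumes F: "analytic2_on F U"
    and G: "\<And>z. z \<in> U \<Longrightarrow> \<exists>g. (G has_field_derivative g) (at (F z))"
  shows "analytic2_on (\<lambda>z. G (F z)) U"
  unfolding analytic2_on_def
proof
  fix z assume z: "z \<in> U"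
  from F z obtain a b where F': "(F has_derivative (\<lambda>v. a * fst v + b * snd v)) (at z)"
    unfolding analytic2_on_def by blast
  from G[OF z] obtain g where "(G has_derivative (*) g) (at (F z))"
    by (auto simp: has_field_derivative_def)
  from has_derivative_compose[OF F' this]
  have "((\<lambda>z. G (F z)) has_derivative (\<lambda>v. (g * a) * fst v + (g * b) * snd v)) (at z)"
    by (simp add: algebra_simps)
  then show "\<exists>a b. ((\<lambda>z. G (F z)) has_derivative (\<lambda>v. a * fst v + b * snd v)) (at z)" by blast
qed

lemma analytic2_fst: "analytic2_on fst U"
proof -
  have "(fst has_derivative (\<lambda>v. 1 * fst v + 0 * snd v)) (at z)" for z :: "complex \<times> complex"
    by (auto intro!: derivative_eq_intros)
  then show ?thesis unfolding analytic2_on_def by blast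
qed

lemma analytic2_const: "analytic2_on (\<lambda>z. c) U"
  by (rule analytic2_comp[OF analytic2_fst]) (auto intro: derivative_eq_intros)

lemma analytic2_add:
  assumes "analytic2_on F U" "analytic2_on G U"
  shows "analytic2_on (\<lambda>z. F z + G z) U"
  unfolding analytic2_on_def
proof
  fix z assume z: "z \<in> U"
  obtain a b where F': "(F has_derivative (\<lambda>v. a * fst v + b * snd v)) (at z)"
    using assms(1) z unfolding analytic2_on_def by blast
  obtain c d where G': "(G has_derivative (\<lambda>v. c * fst v + d * snd v)) (at z)"
    using assms(2) z unfolding analytic2_on_def by blast
  from has_derivative_add[OF F' G']
  have "((\<lambda>z. F z + G z) has_derivative (\<lambda>v. (a + c) * fst v + (b + d) * snd v)) (at z)"
    by (simp add: algebra_simps)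
  then show "\<exists>a b. ((\<lambda>z. F z + G z) has_derivative (\<lambda>v. a * fst v + b * snd v)) (at z)" by blast
qed

lemma analytic2_pole: "analytic2_on (\<lambda>z. c / (fst z - of_real a)) UHP2"
proof (rule analytic2_comp[OF analytic2_fst])
  fix z assume "z \<in> UHP2"
  then have "fst z - of_real a \<noteq> 0" using UHP2_D(1)[of z] by (auto simp: complex_eq_iff)
  then show "\<exists>g. ((\<lambda>u. c / (u - of_real a)) has_field_derivative g) (at (fst z))"
    by (auto intro!: exI derivative_eq_intros)
qed

lemma pickfun_const: "Im c \<ge> 0 \<Longrightarrow> pickfun (\<lambda>z. c)"
  by (simp add: pickfun_def analytic2_const)

lemma pickfun_add: "pickfun F \<Longrightarrow> pickfun G \<Longrightarrow> pickfun (\<lambda>z. F z + G z)"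
  by (auto simp: pickfun_def intro: analytic2_add)

lemma swap_in_UHP2 [simp]: "prod.swap z \<in> UHP2 \<longleftrightarrow> z \<in> UHP2"
  by (cases z) auto

lemma pickfun_swap:
  assumes F: "pickfun F"
  shows "pickfun (\<lambda>z. F (prod.swap z))"
  unfolding pickfun_def analytic2_on_def
proof (intro conjI ballI)
  fix z assume z: "z \<in> UHP2"
  then show "Im (F (prod.swap z)) \<ge> 0" using F by (simp add: pickfun_Im)
  obtain a b where F': "(F has_derivative (\<lambda>v. a * fst v + b * snd v)) (at (prod.swap z))"
    using pickfun_deriv[OF F, of "prod.swap z"] z by auto
  have "(prod.swap has_derivative prod.swap) (at z)"
    unfolding prod.swap_def[abs_def] by (auto intro!: derivative_eq_intros)
  from has_derivative_compose[OF this F']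
  have "((\<lambda>z. F (prod.swap z)) has_derivative (\<lambda>v. b * fst v + a * snd v)) (at z)"
    by (simp add: algebra_simps)
  then show "\<exists>a b. ((\<lambda>z. F (prod.swap z)) has_derivative (\<lambda>v. a * fst v + b * snd v)) (at z)" by blast
qed

lemma pickfun_slice_snd:
  assumes F: "pickfun F" and z: "z \<in> UHP"
  shows "(\<lambda>w. F (z, w)) holomorphic_on UHP"
  using pickfun_slice_fst[OF pickfun_swap[OF F] z] by simp

lemma pickfun_harnack:
  assumes F: "pickfun F" and "(z, w) \<in> UHP2" "(z', w') \<in> UHP2"
  shows "cmod (F (z, w)) \<le> (2 + (cmod (w - cnj w'))\<^sup>2 / (Im w * Im w')) *
           ((2 + (cmod (z - cnj z'))\<^sup>2 / (Im z * Im z')) * cmod (F (z', w')))"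
proof -
  have UHP: "z \<in> UHP" "w \<in> UHP" "z' \<in> UHP" "w' \<in> UHP" using assms by (auto simp: UHP_def)
  have "cmod (F (z, w)) \<le> (2 + (cmod (w - cnj w'))\<^sup>2 / (Im w * Im w')) * cmod (F (z, w'))"
    using UHP by (intro harnack_inequality[OF pickfun_slice_snd[OF F]]) (auto intro!: pickfun_Im[OF F] simp: UHP_def)
  also have "\<dots> \<le> (2 + (cmod (w - cnj w'))\<^sup>2 / (Im w * Im w')) *
           ((2 + (cmod (z - cnj z'))\<^sup>2 / (Im z * Im z')) * cmod (F (z', w')))"
    using UHP by (intro mult_left_mono harnack_inequality[OF pickfun_slice_fst[OF F]])
      (auto intro!: pickfun_Im[OF F] add_nonneg_nonneg simp: UHP_def)
  finally show ?thesis .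
qed

text \<open>If \<open>F\<close> has a zero, it vanishes identically, and \<open>- 1 / F\<close> is the zero function by the
convention \<open>1 / 0 = 0\<close>. This covers the constant function \<open>h = \<xi>\<close>.\<close>

lemma pickfun_neg_inverse:
  assumes F: "pickfun F"
  shows "pickfun (\<lambda>z. - 1 / F z)"
proof (cases "\<exists>z\<in>UHP2. F z = 0")
  case True
  then obtain z' w' where 0: "(z', w') \<in> UHP2" "F (z', w') = 0" by (metis surj_pair)
  have zero: "F z = 0" if "z \<in> UHP2" for z
    using pickfun_harnack[OF F _ 0(1), of "fst z" "snd z"] that 0(2) by simp
  have "((\<lambda>z. - 1 / F z) has_derivative (\<lambda>v. 0 * fst v + 0 * snd v)) (at z)" if "z \<in> UHP2" for z
    by (rule has_derivative_transform_within_open[OF _ open_UHP2 that, of "\<lambda>_. 0"]) (auto simp: zero)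
  then have "analytic2_on (\<lambda>z. - 1 / F z) UHP2" unfolding analytic2_on_def by blast
  then show ?thesis unfolding pickfun_def using zero by simp
next
  case False
  show ?thesis
    unfolding pickfun_def
  proof (intro conjI ballI)
    show "analytic2_on (\<lambda>z. - 1 / F z) UHP2"
    proof (rule analytic2_comp[where G = "\<lambda>u. - 1 / u"])
      show "analytic2_on F UHP2" using F by (simp add: pickfun_def)
      fix z assume "z \<in> UHP2"
      with False have "F z \<noteq> 0" by blast
      then show "\<exists>g. ((\<lambda>u. - 1 / u) has_field_derivative g) (at (F z))"
        by (auto intro!: exI derivative_eq_intros)
    qed
    fix z assume "z \<in> UHP2"
    then show "0 \<le> Im (- 1 / F z)"
      using pickfun_Im[OF F] by (simp add: Im_divide)
  qed
qed

lemma pickfun_pole: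
  assumes "c \<ge> 0"
  shows "pickfun (\<lambda>z. - of_real c / (fst z - of_real a))"
  unfolding pickfun_def
proof (intro conjI ballI analytic2_pole)
  fix z assume "z \<in> UHP2"
  then show "0 \<le> Im (- of_real c / (fst z - of_real a))"
    using assms UHP2_D(1)[of z] by (simp add: Im_divide)
qed

section \<open>Point masses on the facets\<close>

text \<open>For a Pick function \<open>F\<close> and \<open>x = (a, p)\<close> with real \<open>a\<close>, the number \<open>c\<close> is the mass at \<open>a\<close> of the measure in the Nevanlinna
representation of the slice \<open>F (\<cdot>, p)\<close>; the normalisation is such that \<open>- c / (z\<^sup>1 - a)\<close> has mass \<open>c\<close>.\<close>

definition point_mass :: "(complex \<times> complex \<Rightarrow> complex) \<Rightarrow> complex \<times> complex \<Rightarrow> real \<Rightarrow> bool" where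
  "point_mass F x c \<longleftrightarrow> ((\<lambda>t. of_real t * F (x + t *\<^sub>R (\<i>, 0))) \<longlongrightarrow> \<i> * of_real c) (at_right (0::real))"

text \<open>The functions \<open>G\<^sub>t(w) = t F (a + i t, w)\<close> are Pick functions of \<open>w\<close>. They converge at \<open>w\<^sub>0\<close>, so they are
locally bounded by Harnack's inequality, and Montel's theorem gives a sequence with a holomorphic
limit \<open>g\<close>. All values of \<open>g\<close> are purely imaginary, so \<open>g\<close> is constant. A limit along a sequence is
all that Julia's inequality asks for.\<close>

lemma point_mass_indep:
  fixes F :: "complex \<times> complex \<Rightarrow> complex" and a c :: real
  assumes F: "pickfun F" and w0: "w0 \<in> UHP" and w: "w \<in> UHP"
    and mass: "point_mass F (of_real a, w0) c"
  obtains t :: "nat \<Rightarrow> real" where "\<And>n. t n > 0" "t \<longlonglongrightarrow> 0"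
    "(\<lambda>n. t n * F (a + \<i> * t n, w)) \<longlonglongrightarrow> \<i> * c"
proof -
  define s where "s = (\<lambda>n. inverse (real (Suc n)))"
  define G where "G = (\<lambda>n w. s n * F (a + \<i> * s n, w))"
  have s0: "s n > 0" for n by (simp add: s_def)
  have s: "s \<longlonglongrightarrow> 0" unfolding s_def by (rule LIMSEQ_inverse_real_of_nat)
  have "filterlim s (at_right 0) sequentially"
    using s s0 by (intro tendsto_imp_filterlim_at_right) auto
  from filterlim_compose[OF mass[unfolded point_mass_def] this]
  have Gw0: "(\<lambda>n. G n w0) \<longlonglongrightarrow> \<i> * c"
    by (simp add: G_def scaleR_conv_of_real mult.commute)
  then obtain B where B: "\<And>n. cmod (G n w0) \<le> B"
    by (meson Bseq_def convergentI convergent_imp_Bseq)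
  have sUHP: "a + \<i> * s n \<in> UHP" for n using s0[of n] by (simp add: UHP_def)
  have holG: "G n holomorphic_on UHP" for n
    unfolding G_def of_real_mult
    by (intro holomorphic_intros pickfun_slice_snd[OF F] sUHP)
  have posG: "Im (G n w) \<ge> 0" if "w \<in> UHP" for n w
    using that sUHP[of n] s0[of n] pickfun_Im[OF F, of "(a + \<i> * s n, w)"]
    by (simp add: G_def UHP_def)
  have bdd: "\<exists>B. \<forall>h\<in>range G. \<forall>w\<in>K. cmod (h w) \<le> B" if K: "compact K" "K \<subseteq> UHP" for K
  proof -
    define k where "k = (\<lambda>w. 2 + (cmod (w - cnj w0))\<^sup>2 / (Im w * Im w0))"
    have "continuous_on K k"
      unfolding k_def using K w0 by (intro continuous_intros) (auto simp: UHP_def)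
    then have "bounded (k ` K)"
      using K by (intro compact_imp_bounded compact_continuous_image)
    then obtain M where M: "\<And>w. w \<in> K \<Longrightarrow> k w \<le> M"
      unfolding bounded_iff by (metis abs_le_D1 image_eqI real_norm_def)
    have "cmod (G n w) \<le> max M 0 * B" if "w \<in> K" for n w
    proof -
      have "w \<in> UHP" using that K by blast
      have "cmod (G n w) \<le> k w * cmod (G n w0)"
        unfolding k_def by (rule harnack_inequality[OF holG posG \<open>w \<in> UHP\<close> w0])
      also have "\<dots> \<le> max M 0 * B"
        using M[OF that] B[of n] by (intro mult_mono) auto
      finally show ?thesis .
    qed
    then show ?thesis by blast
  qed
  obtain g r where holg: "g holomorphic_on UHP" and r: "strict_mono (r :: nat \<Rightarrow> nat)"
    and lim: "\<And>w. w \<in> UHP \<Longrightarrow> (\<lambda>n. G (r n) w) \<longlonglongrightarrow> g w"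
    by (rule Montel[where \<H> = "range G" and \<F> = G, OF open_UHP _ bdd]) (use holG in auto)
  have gw0: "g w0 = \<i> * c"
    using LIMSEQ_subseq_LIMSEQ[OF Gw0 r] lim[OF w0] by (auto simp: o_def intro: LIMSEQ_unique)
  have sr: "(\<lambda>n. s (r n)) \<longlonglongrightarrow> 0" using LIMSEQ_subseq_LIMSEQ[OF s r] by (simp add: o_def)
  have Re0: "Re (g w) = 0" if "w \<in> UHP" for w
  proof (rule residue_imaginary[OF pickfun_slice_fst[OF F that] _ _ sr])
    show "0 \<le> Im (F (z, w))" if "z \<in> UHP" for z
      using that \<open>w \<in> UHP\<close> by (intro pickfun_Im[OF F]) (auto simp: UHP_def)
    show "(\<lambda>n. s (r n) * F (a + \<i> * s (r n), w)) \<longlonglongrightarrow> g w"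
      using lim[OF that] by (simp add: G_def)
  qed (rule s0)
  \<comment> \<open>Since \<open>\<i> g\<close> is real-valued, \<open>\<i> g - \<i> g(w0)\<close> is a Pick function with a zero.\<close>
  have "cmod (\<i> * g w - \<i> * g w0) \<le> (2 + (cmod (w - cnj w0))\<^sup>2 / (Im w * Im w0)) * cmod (\<i> * g w0 - \<i> * g w0)"
    by (rule harnack_inequality[OF _ _ w w0, of "\<lambda>w. \<i> * g w - \<i> * g w0"])
       (auto intro!: holomorphic_intros holg simp: Re0 w0)
  then have "g w = g w0" by simp
  then have "g w = \<i> * c" using gw0 by simp
  with that[of "\<lambda>n. s (r n)"] s0 sr lim[OF w] show ?thesis by (simp add: G_def)
qed

text \<open>In each slice the mass at \<open>a\<close> is \<open>c\<close>, so Julia's inequality bounds \<open>Im F\<close> from below by the imaginary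
part \<open>c Im z\<^sup>1 / |z\<^sup>1 - a|\<^sup>2\<close> of the pole that is removed.\<close>

lemma pickfun_remove_mass:
  assumes F: "pickfun F" and w0: "w0 \<in> UHP" and c: "c > 0"
    and mass: "point_mass F (of_real a, w0) c"
  shows "pickfun (\<lambda>z. F z + of_real c / (fst z - of_real a))"
  unfolding pickfun_def
proof (intro conjI ballI)
  show "analytic2_on (\<lambda>z. F z + of_real c / (fst z - of_real a)) UHP2"
    using F by (intro analytic2_add analytic2_pole) (simp add: pickfun_def)
  fix z assume z: "z \<in> UHP2"
  obtain z1 z2 where zz: "z = (z1, z2)" by (cases z)
  have U: "z1 \<in> UHP" "z2 \<in> UHP" using z zz by (auto simp: UHP_def)
  obtain t where t: "\<And>n. t n > (0::real)" "t \<longlonglongrightarrow> 0"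
    "(\<lambda>n. t n * F (a + \<i> * t n, z2)) \<longlonglongrightarrow> \<i> * c"
    using point_mass_indep[OF F w0 U(2) mass] by blast
  have pos: "0 \<le> Im (F (z, z2))" if "z \<in> UHP" for z
    using that U by (intro pickfun_Im[OF F]) (auto simp: UHP_def)
  have "Im z1 * (cmod (\<i> * c))\<^sup>2 \<le> Im (F (z1, z2)) * Im (\<i> * c) * (cmod (z1 - a))\<^sup>2"
    by (rule julia_inequality[OF pickfun_slice_fst[OF F U(2)] pos t U(1)])
  then have "c * (c * Im z1) \<le> c * (Im (F z) * (cmod (z1 - a))\<^sup>2)"
    using c by (simp add: zz norm_mult power2_eq_square algebra_simps)
  then have j: "c * Im z1 \<le> Im (F z) * (cmod (z1 - a))\<^sup>2" using c by simp
  have "z1 - a \<noteq> 0" using U by (auto simp: complex_eq_iff UHP_def)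
  then have "(cmod (z1 - a))\<^sup>2 > 0" by simp
  moreover have "Im (of_real c / (z1 - a)) = - c * Im z1 / (cmod (z1 - a))\<^sup>2"
    unfolding cmod_power2 by (simp add: Im_divide)
  ultimately have "Im (F z) + Im (of_real c / (z1 - a)) \<ge> 0"
    using j by (simp add: pos_divide_le_eq del: zero_less_power2 zero_less_norm_iff)
  then show "0 \<le> Im (F z + of_real c / (fst z - of_real a))"
    by (simp add: zz)
qed

section \<open>Nontangential approach to a facet\<close>

text \<open>Both \<open>z\<^sup>1\<close> and \<open>a + i Im z\<^sup>1\<close>, and both \<open>z\<^sup>2\<close> and \<open>p\<close>, are at bounded hyperbolic distance. The factor
\<open>15 = 2 + 13\<close> comes from \<open>|z\<^sup>2 - cnj p| \<le> 5/2 Im p\<close> and \<open>Im z\<^sup>2 \<ge> Im p / 2\<close>, which give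
\<open>|z\<^sup>2 - cnj p|\<^sup>2 / (Im z\<^sup>2 Im p) \<le> 25/2\<close>.\<close>

lemma pickfun_nontangential_bound:
  fixes F :: "complex \<times> complex \<Rightarrow> complex" and z :: "complex \<times> complex" and a K :: real
  assumes F: "pickfun F" and p: "p \<in> UHP" and z: "z \<in> UHP2"
    and K: "cmod (fst z - a) \<le> K * Im (fst z)"
    and near: "cmod (snd z - p) \<le> Im p / 2"
  shows "cmod ((fst z - a) * F z) \<le>
     (K * (2 + (K + 1)\<^sup>2) * 15) * cmod (Im (fst z) * F (a + \<i> * Im (fst z), p))"
proof -
  obtain z1 z2 where zz: "z = (z1, z2)" by (cases z)
  define t where "t = Im z1"
  have t: "t > 0" and z2: "Im z2 > 0" and p0: "Im p > 0"
    using z p by (auto simp: zz t_def UHP_def)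
  have Kt: "cmod (z1 - a) \<le> K * t" using K by (simp add: zz t_def)
  then have "0 \<le> K * t" using norm_ge_zero order_trans by blast
  then have K0: "K \<ge> 0" using t by (simp add: zero_le_mult_iff)
  have k1: "(cmod (z1 - cnj (a + \<i> * t)))\<^sup>2 / (Im z1 * Im (a + \<i> * t)) \<le> (K + 1)\<^sup>2"
  proof -
    have "cmod (z1 - cnj (a + \<i> * t)) = cmod ((z1 - a) + \<i> * t)" by (simp add: algebra_simps)
    also have "\<dots> \<le> (K + 1) * t"
      using norm_triangle_ineq[of "z1 - a" "\<i> * t"] Kt t by (simp add: norm_mult algebra_simps)
    finally have "(cmod (z1 - cnj (a + \<i> * t)))\<^sup>2 \<le> ((K + 1) * t)\<^sup>2" by (rule power_mono) simp
    then show ?thesis using t by (simp add: t_def[symmetric] divide_simps power2_eq_square mult_ac)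
  qed
  have k2: "(cmod (z2 - cnj p))\<^sup>2 / (Im z2 * Im p) \<le> 13"
  proof -
    have n: "cmod (z2 - p) \<le> Im p / 2" using near by (simp add: zz)
    have "\<bar>Im (z2 - p)\<bar> \<le> Im p / 2" using abs_Im_le_cmod n by (rule order_trans)
    then have i: "Im z2 \<ge> Im p / 2" using abs_le_D2[of "Im (z2 - p)" "Im p / 2"] by simp
    have "z2 - cnj p = (z2 - p) + 2 * \<i> * Im p" by (simp add: complex_eq_iff)
    then have "cmod (z2 - cnj p) \<le> 5 / 2 * Im p"
      using norm_triangle_ineq[of "z2 - p" "2 * \<i> * Im p"] n p0 by (simp only:) (simp add: norm_mult)
    then have "(cmod (z2 - cnj p))\<^sup>2 \<le> (5 / 2 * Im p)\<^sup>2" by (rule power_mono) simp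
    also have "\<dots> \<le> 13 * (Im p / 2 * Im p)" using p0 by (simp add: power2_eq_square)
    also have "\<dots> \<le> 13 * (Im z2 * Im p)" using i p0 by (intro mult_left_mono mult_right_mono) auto
    finally show ?thesis using z2 p0 by (simp add: divide_simps)
  qed
  have "cmod (F (z1, z2)) \<le> (2 + (cmod (z2 - cnj p))\<^sup>2 / (Im z2 * Im p)) *
      ((2 + (cmod (z1 - cnj (a + \<i> * t)))\<^sup>2 / (Im z1 * Im (a + \<i> * t))) * cmod (F (a + \<i> * t, p)))"
    by (rule pickfun_harnack[OF F]) (use z t p0 in \<open>auto simp: zz\<close>)
  also have "\<dots> \<le> 15 * ((2 + (K + 1)\<^sup>2) * cmod (F (a + \<i> * t, p)))"
    using k1 k2 t z2 p0 by (intro mult_mono mult_nonneg_nonneg add_nonneg_nonneg) (auto simp: t_def)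
  finally have "cmod (z1 - a) * cmod (F (z1, z2)) \<le> (K * t) * (15 * ((2 + (K + 1)\<^sup>2) * cmod (F (a + \<i> * t, p))))"
    using Kt K0 t by (intro mult_mono) auto
  moreover have "cmod ((fst z - a) * F z) = cmod (z1 - a) * cmod (F (z1, z2))"
    by (simp add: zz norm_mult)
  ultimately have "cmod ((fst z - a) * F z) \<le> (K * t) * (15 * ((2 + (K + 1)\<^sup>2) * cmod (F (a + \<i> * t, p))))"
    by simp
  also have "\<dots> = (K * (2 + (K + 1)\<^sup>2) * 15) * cmod (Im (fst z) * F (a + \<i> * Im (fst z), p))"
    using t by (simp add: zz norm_mult t_def[symmetric] mult_ac)
  finally show ?thesis .
qed

lemma dist_compl_eq:
  assumes z: "z \<in> UHP2"
  shows "dist_compl z = min (Im (fst z)) (Im (snd z))"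
proof -
  obtain z1 z2 where zz: "z = (z1, z2)" by (cases z)
  have le: "min (Im z1) (Im z2) \<le> maxnorm (z - w)" if "w \<in> - UHP2" for w
  proof -
    have "Im (fst w) \<le> 0 \<or> Im (snd w) \<le> 0" using that by (cases w) auto
    moreover have "Im (z1 - fst w) \<le> cmod (z1 - fst w)" "Im (z2 - snd w) \<le> cmod (z2 - snd w)"
      by (meson abs_Im_le_cmod abs_le_D1)+
    ultimately show ?thesis by (auto simp: zz maxnorm_def)
  qed
  have bdd: "bdd_below ((\<lambda>w. maxnorm (z - w)) ` (- UHP2))" using le by (intro bdd_belowI2)
  have "(of_real (Re z1), z2) \<in> - UHP2" "(z1, of_real (Re z2)) \<in> - UHP2" by auto
  from cINF_lower[OF bdd this(1)] cINF_lower[OF bdd this(2)]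
  have "dist_compl z \<le> cmod (z1 - Re z1)" "dist_compl z \<le> cmod (z2 - Re z2)"
    by (auto simp: dist_compl_def zz maxnorm_def)
  moreover have "cmod (z1 - Re z1) = Im z1" "cmod (z2 - Re z2) = Im z2"
    using z by (auto simp: zz cmod_def)
  moreover have "min (Im z1) (Im z2) \<le> dist_compl z"
    unfolding dist_compl_def using \<open>(z1, of_real (Re z2)) \<in> - UHP2\<close> le by (intro cINF_greatest) blast+
  ultimately show ?thesis by (simp add: zz)
qed

lemma approaches_ntD:
  assumes "approaches_nt S x"
  obtains K where "S \<subseteq> UHP2" "\<And>z. z \<in> S \<Longrightarrow> maxnorm (z - x) \<le> K * Im (fst z)"
proof -
  obtain K where S: "S \<subseteq> UHP2" and K: "\<And>z. z \<in> S \<Longrightarrow> maxnorm (z - x) / dist_compl z \<le> K"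
    using assms unfolding approaches_nt_def by blast
  have "maxnorm (z - x) \<le> \<bar>K\<bar> * Im (fst z)" if "z \<in> S" for z
  proof -
    have d: "dist_compl z > 0" "dist_compl z \<le> Im (fst z)"
      using that S UHP2_D[of z] by (auto simp: dist_compl_eq)
    have "maxnorm (z - x) \<le> K * dist_compl z" using K[OF that] d by (simp add: pos_divide_le_eq)
    also have "\<dots> \<le> \<bar>K\<bar> * Im (fst z)" using d by (intro mult_mono) auto
    finally show ?thesis .
  qed
  with S that show ?thesis by blast
qed

lemma maxnorm_pos: "z \<noteq> 0 \<Longrightarrow> maxnorm z > 0"
  by (auto simp: maxnorm_def prod_eq_iff less_max_iff_disj)

lemma tendsto_ray: "((\<lambda>t. x + t *\<^sub>R (v :: complex \<times> complex)) \<longlongrightarrow> x) (at_right (0::real))"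
proof -
  have "((\<lambda>t. x + t *\<^sub>R v) \<longlongrightarrow> x + 0 *\<^sub>R v) (at_right (0::real))"
    by (intro tendsto_intros)
  then show ?thesis by (simp only: scaleR_zero_left add_0_right)
qed

lemma facet_frontier:
  assumes "x \<in> \<real> \<times> UHP"
  shows "x \<in> frontier UHP2"
proof -
  obtain a p where x: "x = (of_real a, p)" and p: "Im p > 0"
    using assms by (auto simp: UHP_def Reals_def)
  have "x + t *\<^sub>R (\<i>, 0) \<in> UHP2" if "t > 0" for t using that p by (simp add: x)
  moreover have "((\<lambda>t. x + t *\<^sub>R (\<i>, 0)) \<longlongrightarrow> x) (at_right (0::real))"
    by (rule tendsto_ray)
  ultimately have "x \<in> closure UHP2"
    by (intro Lim_in_closed_set[of "closure UHP2" "\<lambda>t. x + t *\<^sub>R (\<i>, 0)" "at_right (0::real)"])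
       (auto intro!: eventually_at_rightI[of 0 1] closure_subset[THEN subsetD])
  then show ?thesis using x by (simp add: frontier_def interior_open[OF open_UHP2])
qed

text \<open>The segment is cut off at height \<open>Im x\<^sup>2\<close>, so that the distance of \<open>x + i t e\<^sub>1\<close> to the complement
of \<^const>\<open>UHP2\<close> is exactly \<open>t\<close>.\<close>

definition ray :: "complex \<times> complex \<Rightarrow> (complex \<times> complex) set" where
  "ray x = (\<lambda>t. x + t *\<^sub>R (\<i>, 0)) ` {0 <.. Im (snd x)}"

lemma filterlim_ray:
  assumes "x \<in> \<real> \<times> UHP"
  shows "filterlim (\<lambda>t. x + t *\<^sub>R (\<i>, 0)) (at x within ray x) (at_right (0::real))"
  unfolding filterlim_at
proof
  have "Im (snd x) > 0" using assms by (auto simp: UHP_def)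
  then show "\<forall>\<^sub>F t in at_right 0. x + t *\<^sub>R (\<i>, 0) \<in> ray x \<and> x + t *\<^sub>R (\<i>, 0) \<noteq> x"
    by (intro eventually_at_rightI[of 0 "Im (snd x)"]) (auto simp: ray_def prod_eq_iff)
  show "((\<lambda>t. x + t *\<^sub>R (\<i>, 0)) \<longlongrightarrow> x) (at_right (0::real))"
    by (rule tendsto_ray)
qed

lemma ray_subset: "x \<in> \<real> \<times> UHP \<Longrightarrow> ray x \<subseteq> UHP2"
  by (auto simp: ray_def UHP_def complex_is_Real_iff)

lemma ray_approaches_nt:
  assumes x: "x \<in> \<real> \<times> UHP"
  shows "approaches_nt (ray x) x"
  unfolding approaches_nt_def
proof (intro conjI ray_subset[OF x] facet_frontier[OF x] exI ballI)
  have pos: "Im (snd x) > 0" and re: "Im (fst x) = 0"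
    using x by (auto simp: UHP_def complex_is_Real_iff)
  have "((\<lambda>t. x + t *\<^sub>R (\<i>, 0)) \<longlongrightarrow> x) (at_right (0::real))"
    by (rule tendsto_ray)
  then show "x \<in> closure (ray x)"
    by (intro Lim_in_closed_set[of "closure (ray x)" "\<lambda>t. x + t *\<^sub>R (\<i>, 0)" "at_right (0::real)"])
       (use pos in \<open>auto intro!: eventually_at_rightI[of 0 "Im (snd x)"] closure_subset[THEN subsetD] simp: ray_def\<close>)
  fix z assume z: "z \<in> ray x"
  then obtain t where t: "0 < t" "t \<le> Im (snd x)" "z = x + t *\<^sub>R (\<i>, 0)" by (auto simp: ray_def)
  have "dist_compl z = t" using z ray_subset[OF x] t re by (auto simp: dist_compl_eq)
  then show "maxnorm (z - x) / dist_compl z \<le> 1" using t by (simp add: maxnorm_def norm_scaleR)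
qed

lemma tendsto_nontangential_of_massless:
  fixes a :: real
  assumes x: "x = (of_real a, p)" and p: "p \<in> UHP" and F: "pickfun F" and 0: "point_mass F x 0"
    and nt: "approaches_nt S x"
  shows "((\<lambda>z. (fst z - a) * F z) \<longlongrightarrow> 0) (at x within S)"
proof -
  obtain K where S: "S \<subseteq> UHP2" and K: "\<And>z. z \<in> S \<Longrightarrow> maxnorm (z - x) \<le> K * Im (fst z)"
    using approaches_ntD[OF nt] by blast
  have inS: "\<forall>\<^sub>F z in at x within S. z \<in> S" by (simp add: eventually_at_filter)
  have Im: "filterlim (\<lambda>z. Im (fst z)) (at_right 0) (at x within S)"
  proof (rule tendsto_imp_filterlim_at_right)
    show "((\<lambda>z. Im (fst z)) \<longlongrightarrow> 0) (at x within S)"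
      by (auto intro!: tendsto_eq_intros simp: x)
    show "\<forall>\<^sub>F z in at x within S. 0 < Im (fst z)"
      using inS by eventually_elim (use S UHP2_D in blast)
  qed
  have "((\<lambda>z. Im (fst z) * F (a + \<i> * Im (fst z), p)) \<longlongrightarrow> 0) (at x within S)"
    using filterlim_compose[OF 0[unfolded point_mass_def] Im]
    by (simp add: x scaleR_conv_of_real mult.commute)
  moreover have "((\<lambda>z. cmod (snd z - p)) \<longlongrightarrow> 0) (at x within S)"
    by (auto intro!: tendsto_eq_intros simp: x)
  then have "\<forall>\<^sub>F z in at x within S. cmod (snd z - p) < Im p / 2"
    by (rule order_tendstoD) (use p in \<open>simp add: UHP_def\<close>)
  then have "\<forall>\<^sub>F z in at x within S. cmod ((fst z - a) * F z) \<le>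
      cmod (Im (fst z) * F (a + \<i> * Im (fst z), p)) * (K * (2 + (K + 1)\<^sup>2) * 15)"
    using inS
  proof eventually_elim
    case (elim z)
    have "cmod (fst z - a) \<le> maxnorm (z - x)" by (simp add: maxnorm_def x)
    also have "\<dots> \<le> K * Im (fst z)" by (rule K) (rule elim)
    finally show ?case
      using pickfun_nontangential_bound[OF F p, of z a K] elim S by (auto simp: mult.commute)
  qed
  ultimately show ?thesis by (rule tendsto_0_le)
qed

definition facet_data ::
  "(complex \<times> complex \<Rightarrow> complex) \<Rightarrow> complex \<times> complex \<Rightarrow> real \<Rightarrow> complex \<times> complex \<Rightarrow> bool" where
  "facet_data h x \<xi> \<eta> \<longleftrightarrow>
     B_point h x \<and> has_nt_limit h x (of_real \<xi>) \<and> has_angular_gradient h x \<eta>"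

lemma linear_expansion_iff:
  "linear_expansion h x S \<omega> \<eta> \<longleftrightarrow>
     ((\<lambda>z. (h z - (of_real \<omega> + fst \<eta> * (fst z - fst x) + snd \<eta> * (snd z - snd x)))
        / of_real (maxnorm (z - x))) \<longlongrightarrow> 0) (at x within S)"
proof -
  have "\<forall>\<^sub>F z in at x within S. z \<noteq> x" by (simp add: eventually_at_filter)
  then have nz: "\<forall>\<^sub>F z in at x within S. complex_of_real (maxnorm (z - x)) \<noteq> 0"
    by eventually_elim (simp add: less_imp_neq[OF maxnorm_pos, symmetric])
  show ?thesis
    unfolding linear_expansion_def by (rule iffI[OF smalloD_tendsto smalloI_tendsto[OF _ nz]])
qed

section \<open>Boundary data as point masses\<close>

text \<open>The second component of the gradient is zero, so the nontangential limit of one difference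
quotient controls everything: it gives the expansion since \<open>|z\<^sup>1 - x\<^sup>1| \<le> \<parallel>z - x\<parallel>\<close>, and along
the ray it bounds \<open>Im h / Im z\<^sup>1\<close>. Along the ray \<open>Im z\<^sup>2\<close> is constant, so \<open>Im h / Im z\<^sup>2\<close> tends to \<open>0\<close>.\<close>

lemma facet_dataI:
  assumes x: "x \<in> \<real> \<times> UHP"
    and quot: "\<And>S. approaches_nt S x \<Longrightarrow>
      ((\<lambda>z. (h z - of_real \<xi>) / (fst z - fst x)) \<longlongrightarrow> of_real \<beta>) (at x within S)"
  shows "facet_data h x \<xi> (of_real \<beta>, 0)"
  unfolding facet_data_def
proof (intro conjI)
  have nz: "\<forall>\<^sub>F z in at x within S. fst z - fst x \<noteq> 0" if "S \<subseteq> UHP2" for S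
  proof -
    have "\<forall>\<^sub>F z in at x within S. z \<in> S" by (simp add: eventually_at_filter)
    then show ?thesis
      by eventually_elim (use that x UHP2_D(1) in \<open>force simp: complex_is_Real_iff\<close>)
  qed
  show "has_nt_limit h x (of_real \<xi>)"
    unfolding has_nt_limit_def
  proof (intro allI impI)
    fix S assume S: "approaches_nt S x"
    then have "S \<subseteq> UHP2" by (simp add: approaches_nt_def)
    have "((\<lambda>z. of_real \<xi> + (h z - of_real \<xi>) / (fst z - fst x) * (fst z - fst x)) \<longlongrightarrow> of_real \<xi>) (at x within S)"
      by (rule tendsto_eq_intros refl quot[OF S] | simp)+
    moreover have "\<forall>\<^sub>F z in at x within S. of_real \<xi> + (h z - of_real \<xi>) / (fst z - fst x) * (fst z - fst x) = h z"
      using nz[OF \<open>S \<subseteq> UHP2\<close>] by eventually_elim simp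
    ultimately show "(h \<longlongrightarrow> of_real \<xi>) (at x within S)" by (simp add: tendsto_cong)
  qed
  have exp: "linear_expansion h x S \<xi> (of_real \<beta>, 0)" if S: "approaches_nt S x" for S
    unfolding linear_expansion_iff
  proof (rule tendsto_0_le[where K = 1])
    from S have "S \<subseteq> UHP2" by (simp add: approaches_nt_def)
    show "((\<lambda>z. (h z - of_real \<xi>) / (fst z - fst x) - of_real \<beta>) \<longlongrightarrow> 0) (at x within S)"
      using tendsto_diff[OF quot[OF S] tendsto_const[of "of_real \<beta>"]] by simp
    have "\<forall>\<^sub>F z in at x within S. z \<noteq> x" by (simp add: eventually_at_filter)
    with nz[OF \<open>S \<subseteq> UHP2\<close>]
    show "\<forall>\<^sub>F z in at x within S. cmod ((h z - (of_real \<xi> + fst (of_real \<beta>, 0) * (fst z - fst x)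
        + snd (of_real \<beta>, 0) * (snd z - snd x))) / of_real (maxnorm (z - x)))
      \<le> cmod ((h z - of_real \<xi>) / (fst z - fst x) - of_real \<beta>) * 1"
    proof eventually_elim
      case (elim z)
      then have pos: "maxnorm (z - x) > 0" by (simp add: maxnorm_pos)
      have "h z - (of_real \<xi> + of_real \<beta> * (fst z - fst x)) =
          ((h z - of_real \<xi>) / (fst z - fst x) - of_real \<beta>) * (fst z - fst x)"
        unfolding left_diff_distrib[of "(h z - of_real \<xi>) / (fst z - fst x)"] using elim by simp
      then have "cmod (h z - (of_real \<xi> + of_real \<beta> * (fst z - fst x))) \<le>
          cmod ((h z - of_real \<xi>) / (fst z - fst x) - of_real \<beta>) * maxnorm (z - x)"
        by (auto simp: norm_mult maxnorm_def intro!: mult_left_mono)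
      then show ?case using pos by (simp add: norm_divide divide_simps)
    qed
  qed
  then show "has_angular_gradient h x (of_real \<beta>, 0)"
    unfolding has_angular_gradient_def C_point_def using facet_frontier[OF x] by blast
  show "B_point h x"
    unfolding B_point_def
  proof (intro conjI facet_frontier[OF x])
    have re: "Im (fst x) = 0" and pos: "Im (snd x) > 0"
      using x by (auto simp: complex_is_Real_iff UHP_def)
    let ?R = "filtermap (\<lambda>t. x + t *\<^sub>R (\<i>, 0)) (at_right (0::real))"
    have le: "?R \<le> at x within UHP2"
      using filterlim_ray[OF x] at_le[OF ray_subset[OF x], of x] unfolding filterlim_def by (rule order_trans)
    have fin: "Liminf (at x within UHP2) (\<lambda>z. ereal (f z)) < \<infinity>"
      if "((\<lambda>t. f (x + t *\<^sub>R (\<i>, 0))) \<longlongrightarrow> l) (at_right (0::real))" for f l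
    proof -
      have "(f \<longlongrightarrow> l) ?R" using that by (simp add: filterlim_filtermap)
      then have "((\<lambda>z. ereal (f z)) \<longlongrightarrow> ereal l) ?R" by simp
      then have "Liminf ?R (\<lambda>z. ereal (f z)) = ereal l"
        by (intro lim_imp_Liminf) (simp add: filtermap_bot_iff)
      moreover have "Liminf (at x within UHP2) (\<lambda>z. ereal (f z)) \<le> Liminf ?R (\<lambda>z. ereal (f z))"
        unfolding Liminf_def using le by (intro SUP_subset_mono) (auto simp: filter_leD)
      ultimately show ?thesis by (metis ereal_infty_less(1) le_less_trans less_ereal.simps(4) not_le)
    qed
    have q: "((\<lambda>t. (h (x + t *\<^sub>R (\<i>, 0)) - of_real \<xi>) / (\<i> * of_real t)) \<longlongrightarrow> of_real \<beta>) (at_right (0::real))"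
      using filterlim_compose[OF quot[OF ray_approaches_nt[OF x]] filterlim_ray[OF x]]
      by (simp add: scaleR_conv_of_real mult.commute)
    have q1: "((\<lambda>t. Im (h (x + t *\<^sub>R (\<i>, 0))) / t) \<longlongrightarrow> \<beta>) (at_right (0::real))"
      using tendsto_Re[OF q, unfolded Re_complex_of_real] by (rule Lim_transform_eventually)
       (auto simp: Re_divide power2_eq_square intro!: eventually_at_rightI[of 0 1])
    then show "Liminf (at x within UHP2) (\<lambda>z. ereal (Im (h z) / Im (fst z))) < \<infinity>"
      by (intro fin) (simp add: re)
    have "((\<lambda>t. (Im (h (x + t *\<^sub>R (\<i>, 0))) / t) * (t / Im (snd x))) \<longlongrightarrow> \<beta> * (0 / Im (snd x))) (at_right (0::real))"
      using pos by (intro tendsto_intros q1) auto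
    then have "((\<lambda>t. Im (h (x + t *\<^sub>R (\<i>, 0))) / Im (snd x)) \<longlongrightarrow> \<beta> * (0 / Im (snd x))) (at_right (0::real))"
      by (rule Lim_transform_eventually) (rule eventually_at_rightI[of 0 1], auto)
    then show "Liminf (at x within UHP2) (\<lambda>z. ereal (Im (h z) / Im (snd z))) < \<infinity>"
      by (intro fin) simp
  qed
qed

text \<open>The constant term \<open>\<omega>\<close> of the expansion is identified with \<open>\<xi>\<close> because both are limits of \<open>h\<close> along
the ray.\<close>

lemma facet_dataD:
  assumes x: "x \<in> \<real> \<times> UHP" and h: "facet_data h x \<xi> (of_real \<beta>, 0)"
  shows "((\<lambda>t. (h (x + t *\<^sub>R (\<i>, 0)) - of_real \<xi>) / (\<i> * of_real t)) \<longlongrightarrow> of_real \<beta>) (at_right (0::real))"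
proof -
  let ?x = "\<lambda>t::real. x + t *\<^sub>R (\<i>, 0)"
  note nt = ray_approaches_nt[OF x]
  from h nt obtain \<omega> where "linear_expansion h x (ray x) \<omega> (of_real \<beta>, 0)"
    unfolding facet_data_def has_angular_gradient_def by blast
  from filterlim_compose[OF this[unfolded linear_expansion_iff] filterlim_ray[OF x]]
  have "((\<lambda>t. (h (?x t) - (of_real \<omega> + of_real \<beta> * (\<i> * of_real t))) / of_real \<bar>t\<bar>) \<longlongrightarrow> 0) (at_right (0::real))"
    by (simp add: maxnorm_def scaleR_conv_of_real norm_mult mult.commute)
  then have e: "((\<lambda>t. (h (?x t) - (of_real \<omega> + of_real \<beta> * (\<i> * of_real t))) / of_real t) \<longlongrightarrow> 0) (at_right (0::real))"
    by (rule Lim_transform_eventually) (rule eventually_at_rightI[of 0 1], auto)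
  have "((\<lambda>t. (h (?x t) - (of_real \<omega> + of_real \<beta> * (\<i> * of_real t))) / of_real t * of_real t
      + (of_real \<omega> + of_real \<beta> * (\<i> * of_real t))) \<longlongrightarrow> of_real \<omega>) (at_right (0::real))"
    by (rule tendsto_eq_intros refl e | simp)+
  then have "((\<lambda>t. h (?x t)) \<longlongrightarrow> of_real \<omega>) (at_right (0::real))"
    by (rule Lim_transform_eventually) (rule eventually_at_rightI[of 0 1], auto)
  moreover have "((\<lambda>t. h (?x t)) \<longlongrightarrow> of_real \<xi>) (at_right (0::real))"
    using h nt unfolding facet_data_def has_nt_limit_def
    by (intro filterlim_compose[OF _ filterlim_ray[OF x]]) simp
  ultimately have "complex_of_real \<omega> = of_real \<xi>" by (rule tendsto_unique[rotated]) simp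
  then have "((\<lambda>t. (h (?x t) - (of_real \<xi> + of_real \<beta> * (\<i> * of_real t))) / of_real t / \<i> + of_real \<beta>) \<longlongrightarrow> 0 / \<i> + of_real \<beta>) (at_right (0::real))"
    using e by (intro tendsto_intros) auto
  then have "((\<lambda>t. (h (?x t) - (of_real \<xi> + of_real \<beta> * (\<i> * of_real t))) / of_real t / \<i> + of_real \<beta>) \<longlongrightarrow> of_real \<beta>) (at_right (0::real))"
    by simp
  then show ?thesis
  proof (rule Lim_transform_eventually)
    show "\<forall>\<^sub>F t in at_right 0. (h (?x t) - (of_real \<xi> + of_real \<beta> * (\<i> * of_real t))) / of_real t / \<i> + of_real \<beta>
        = (h (?x t) - of_real \<xi>) / (\<i> * of_real t)"
      using eventually_at_right_less[of "0::real"]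
    proof eventually_elim
      case (elim t)
      then have "of_real t \<noteq> (0::complex)" by simp
      then show ?case by (simp add: divide_simps) (simp add: algebra_simps)
    qed
  qed
qed

lemma point_mass_add:
  assumes "point_mass F x c" "point_mass G x d"
  shows "point_mass (\<lambda>z. F z + G z) x (c + d)"
  using tendsto_add[OF assms[unfolded point_mass_def]] unfolding point_mass_def
  by (simp add: algebra_simps)

lemma point_mass_isCont:
  assumes "isCont G x"
  shows "point_mass G x 0"
proof -
  have "((\<lambda>t. G (x + t *\<^sub>R (\<i>, 0))) \<longlongrightarrow> G x) (at_right (0::real))"
    using assms tendsto_ray by (rule isCont_tendsto_compose)
  then have "((\<lambda>t. of_real t * G (x + t *\<^sub>R (\<i>, 0))) \<longlongrightarrow> of_real 0 * G x) (at_right (0::real))"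
    by (intro tendsto_intros)
  then show ?thesis by (simp add: point_mass_def)
qed

lemma point_mass_pole: "point_mass (\<lambda>z. of_real k / (fst z - fst x)) x (- k)"
proof -
  have "((\<lambda>t::real. - \<i> * of_real k) \<longlongrightarrow> \<i> * of_real (- k)) (at_right 0)" by simp
  then show ?thesis
    unfolding point_mass_def
    by (rule Lim_transform_eventually)
       (rule eventually_at_rightI[of 0 1], auto simp: scaleR_conv_of_real)
qed

lemma point_mass_cong:
  assumes x: "x \<in> \<real> \<times> UHP" and eq: "\<And>z. z \<in> UHP2 \<Longrightarrow> F z = G z"
  shows "point_mass F x c \<longleftrightarrow> point_mass G x c"
proof -
  have "x + t *\<^sub>R (\<i>, 0) \<in> UHP2" if "t > 0" for t
    using x that by (cases x) (auto simp: UHP_def complex_is_Real_iff)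
  then have "\<forall>\<^sub>F t in at_right (0::real). of_real t * F (x + t *\<^sub>R (\<i>, 0)) = of_real t * G (x + t *\<^sub>R (\<i>, 0))"
    by (intro eventually_at_rightI[of 0 1]) (auto simp: eq)
  then show ?thesis unfolding point_mass_def by (rule tendsto_cong)
qed

lemma pickfun_cong:
  assumes "pickfun F" "\<And>z. z \<in> UHP2 \<Longrightarrow> F z = G z"
  shows "pickfun G"
  unfolding pickfun_def analytic2_on_def
proof (intro conjI ballI)
  fix z assume z: "z \<in> UHP2"
  show "0 \<le> Im (G z)" using pickfun_Im[OF assms(1) z] assms(2)[OF z] by simp
  obtain a b where "(F has_derivative (\<lambda>v. a * fst v + b * snd v)) (at z)"
    using pickfun_deriv[OF assms(1) z] .
  then have "(G has_derivative (\<lambda>v. a * fst v + b * snd v)) (at z)"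
    by (rule has_derivative_transform_within_open[OF _ open_UHP2 z assms(2)])
  then show "\<exists>a b. (G has_derivative (\<lambda>v. a * fst v + b * snd v)) (at z)" by blast
qed

text \<open>From left to right one inverts the difference quotient on the ray. Conversely, the remainder \<open>F0\<close> of
\<open>F\<close> after removal of the mass \<open>1 / \<beta>\<close> is a Pick function without mass, so \<open>(z\<^sup>1 - a) F\<close> tends to
\<open>- 1 / \<beta>\<close> nontangentially, and the difference quotient of \<open>h\<close> is its negative reciprocal.\<close>

lemma facet_data_iff_point_mass:
  assumes h: "pickfun h" and x: "x \<in> \<real> \<times> UHP" and \<beta>: "\<beta> > 0"
  shows "facet_data h x \<xi> (of_real \<beta>, 0) \<longleftrightarrow> point_mass (\<lambda>z. - 1 / (h z - of_real \<xi>)) x (1 / \<beta>)"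
proof
  assume "facet_data h x \<xi> (of_real \<beta>, 0)"
  from facet_dataD[OF x this]
  have "((\<lambda>t. \<i> * inverse ((h (x + t *\<^sub>R (\<i>, 0)) - of_real \<xi>) / (\<i> * of_real t))) \<longlongrightarrow> \<i> * inverse (of_real \<beta>)) (at_right (0::real))"
    using \<beta> by (intro tendsto_intros) auto
  then show "point_mass (\<lambda>z. - 1 / (h z - of_real \<xi>)) x (1 / \<beta>)"
    by (simp add: point_mass_def inverse_eq_divide mult.assoc[symmetric])
next
  define F where "F = (\<lambda>z. - 1 / (h z - of_real \<xi>))"
  assume "point_mass (\<lambda>z. - 1 / (h z - of_real \<xi>)) x (1 / \<beta>)"
  then have mass: "point_mass F x (1 / \<beta>)" by (simp add: F_def)
  obtain a p where xx: "x = (of_real a, p)" and p: "p \<in> UHP" using x by (auto elim: Reals_cases)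
  have "pickfun (\<lambda>z. h z + - of_real \<xi>)" by (intro pickfun_add h pickfun_const) simp
  from pickfun_neg_inverse[OF this] have F: "pickfun F" by (simp add: F_def)
  define F0 where "F0 = (\<lambda>z. F z + of_real (1 / \<beta>) / (fst z - of_real a))"
  have F0: "pickfun F0"
    unfolding F0_def using mass \<beta> by (intro pickfun_remove_mass[OF F p]) (auto simp: xx)
  have mass0: "point_mass F0 x 0"
    using point_mass_add[OF mass point_mass_pole[of "1 / \<beta>" x]] by (simp add: F0_def xx)
  show "facet_data h x \<xi> (of_real \<beta>, 0)"
  proof (rule facet_dataI[OF x])
    fix S assume S: "approaches_nt S x"
    have "((\<lambda>z. - inverse ((fst z - of_real a) * F0 z - of_real (1 / \<beta>))) \<longlongrightarrow> - inverse (0 - of_real (1 / \<beta>))) (at x within S)"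
      by (intro tendsto_intros tendsto_nontangential_of_massless[OF xx p F0 mass0 S]) (use \<beta> in auto)
    then have "((\<lambda>z. - inverse ((fst z - of_real a) * F0 z - of_real (1 / \<beta>))) \<longlongrightarrow> of_real \<beta>) (at x within S)"
      by simp
    then show "((\<lambda>z. (h z - of_real \<xi>) / (fst z - fst x)) \<longlongrightarrow> of_real \<beta>) (at x within S)"
    proof (rule Lim_transform_eventually)
      have "\<forall>\<^sub>F z in at x within S. z \<in> S" by (simp add: eventually_at_filter)
      then show "\<forall>\<^sub>F z in at x within S. - inverse ((fst z - of_real a) * F0 z - of_real (1 / \<beta>))
          = (h z - of_real \<xi>) / (fst z - fst x)"
      proof eventually_elim
        case (elim z)
        then have "z \<in> UHP2" using S by (auto simp: approaches_nt_def)
        then have nz: "fst z - of_real a \<noteq> 0" using UHP2_D(1)[of z] by (auto simp: complex_eq_iff)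
        then have "(fst z - of_real a) * F0 z - of_real (1 / \<beta>) = (fst z - of_real a) * F z"
          unfolding F0_def distrib_left by simp
        then show ?case by (simp add: F_def xx divide_inverse mult.commute)
      qed
    qed
  qed
qed

section \<open>Exchanging the two variables\<close>

text \<open>Everything at points of \<open>UHP \<times> \<real>\<close> follows from the case of \<open>\<real> \<times> UHP\<close> once the boundary
conditions are known to be invariant under the coordinate swap.\<close>

lemma dist_swap: "dist (prod.swap z) (prod.swap x) = dist z x"
  by (simp add: dist_prod_def add.commute)

lemma at_within_swap:
  fixes x :: "'a::metric_space \<times> 'b::metric_space"
  shows "at (prod.swap x) within prod.swap ` S = filtermap prod.swap (at x within S)"
  unfolding filter_eq_iff eventually_filtermap eventually_at
  by (simp add: dist_swap inj_eq[OF inj_swap])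

lemma frontier_UHP2: "x \<in> frontier UHP2 \<longleftrightarrow> x \<notin> UHP2 \<and> x \<in> closure UHP2"
  by (auto simp: frontier_def interior_open[OF open_UHP2])

lemma closure_swap:
  fixes x :: "'a::metric_space \<times> 'b::metric_space"
  shows "prod.swap x \<in> closure (prod.swap ` S) \<longleftrightarrow> x \<in> closure S"
  by (simp add: closure_approachable dist_swap)

lemma swap_UHP2: "prod.swap ` UHP2 = UHP2"
proof -
  have "z \<in> prod.swap ` UHP2" if "z \<in> UHP2" for z
    using that by (intro image_eqI[of _ _ "prod.swap z"]) auto
  then show ?thesis by auto
qed

lemma frontier_swap: "prod.swap x \<in> frontier UHP2 \<longleftrightarrow> x \<in> frontier UHP2"
  using closure_swap[of x UHP2] by (simp add: frontier_UHP2 swap_UHP2)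

lemma maxnorm_swap: "maxnorm (prod.swap z - prod.swap x) = maxnorm (z - x)"
  by (simp add: maxnorm_def max.commute)

lemma approaches_nt_swap:
  assumes "approaches_nt S x"
  shows "approaches_nt (prod.swap ` S) (prod.swap x)"
proof -
  obtain K where S: "S \<subseteq> UHP2" and K: "\<And>z. z \<in> S \<Longrightarrow> maxnorm (z - x) / dist_compl z \<le> K"
    using assms unfolding approaches_nt_def by blast
  have "dist_compl (prod.swap z) = dist_compl z" if "z \<in> S" for z
    using that S by (auto simp: dist_compl_eq min.commute)
  then have "\<forall>z\<in>prod.swap ` S. maxnorm (z - prod.swap x) / dist_compl z \<le> K"
    using K by (auto simp: maxnorm_swap)
  then show ?thesis
    using assms S unfolding approaches_nt_def
    by (auto simp: frontier_swap closure_swap)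
qed

lemma swap_swap_image: "prod.swap ` (prod.swap ` S) = S"
  by (simp add: image_image)

lemma facet_data_swap_imp:
  assumes h: "facet_data h x \<xi> \<eta>"
  shows "facet_data (\<lambda>z. h (prod.swap z)) (prod.swap x) \<xi> (prod.swap \<eta>)"
proof -
  have nt: "approaches_nt (prod.swap ` S) x" if "approaches_nt S (prod.swap x)" for S
    using approaches_nt_swap[OF that] by simp
  have at: "at (prod.swap x) within S = filtermap prod.swap (at x within prod.swap ` S)" for S
    using at_within_swap[of x "prod.swap ` S"] by (simp add: swap_swap_image)
  have lin: "linear_expansion (\<lambda>z. h (prod.swap z)) (prod.swap x) S \<omega> (prod.swap \<eta>)"
    if "linear_expansion h x (prod.swap ` S) \<omega> \<eta>" for S \<omega> \<eta>
    using that unfolding linear_expansion_iff at filterlim_filtermap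
    by (simp add: maxnorm_swap algebra_simps)
  have B: "B_point (\<lambda>z. h (prod.swap z)) (prod.swap x)"
  proof -
    have U: "at (prod.swap x) within UHP2 = filtermap prod.swap (at x within UHP2)"
      using at[of UHP2] by (simp add: swap_UHP2)
    have "Liminf (at (prod.swap x) within UHP2) f \<le> Liminf (at x within UHP2) (\<lambda>z. f (prod.swap z))"
      for f :: "complex \<times> complex \<Rightarrow> ereal"
      unfolding U by (rule Liminf_filtermap_le)
    from this[of "\<lambda>z. ereal (Im (h (prod.swap z)) / Im (fst z))"]
      this[of "\<lambda>z. ereal (Im (h (prod.swap z)) / Im (snd z))"]
    show ?thesis using h unfolding facet_data_def B_point_def
      by (auto simp: frontier_swap)
  qed
  have L: "has_nt_limit (\<lambda>z. h (prod.swap z)) (prod.swap x) (of_real \<xi>)"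
    using h nt unfolding facet_data_def has_nt_limit_def at by (simp add: filterlim_filtermap)
  have C: "C_point (\<lambda>z. h (prod.swap z)) (prod.swap x)"
    using h nt lin unfolding facet_data_def has_angular_gradient_def C_point_def frontier_swap by blast
  have "has_angular_gradient (\<lambda>z. h (prod.swap z)) (prod.swap x) (prod.swap \<eta>)"
    using h nt lin C unfolding facet_data_def has_angular_gradient_def by blast
  with B L show ?thesis by (simp add: facet_data_def)
qed

lemma facet_data_swap:
  "facet_data h y \<xi> (0, \<gamma>) \<longleftrightarrow> facet_data (\<lambda>z. h (prod.swap z)) (prod.swap y) \<xi> (\<gamma>, 0)"
  using facet_data_swap_imp[of h y \<xi> "(0, \<gamma>)"]
    facet_data_swap_imp[of "\<lambda>z. h (prod.swap z)" "prod.swap y" \<xi> "(\<gamma>, 0)"] by auto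

section \<open>Removing all prescribed masses\<close>

text \<open>The masses can be removed one at a time: the poles already removed sit at other real abscissae, so they
are continuous at the next point and do not change its mass.\<close>

lemma pickfun_remove_masses:
  assumes F: "pickfun F" and "finite J"
    and x: "\<And>j. j \<in> J \<Longrightarrow> x j \<in> \<real> \<times> UHP"
    and inj: "inj_on (\<lambda>j. fst (x j)) J"
    and \<beta>: "\<And>j. j \<in> J \<Longrightarrow> \<beta> j > 0"
    and mass: "\<And>j. j \<in> J \<Longrightarrow> point_mass F (x j) (1 / \<beta> j)"
  shows "pickfun (\<lambda>z. F z + (\<Sum>j\<in>J. 1 / (of_real (\<beta> j) * (fst z - fst (x j)))))"
  using \<open>finite J\<close> x inj \<beta> mass
proof (induction J rule: finite_induct)
  case empty
  then show ?case using F by simp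
next
  case (insert k J)
  define G where "G = (\<lambda>z. F z + (\<Sum>j\<in>J. 1 / (of_real (\<beta> j) * (fst z - fst (x j)))))"
  have G: "pickfun G"
    unfolding G_def using insert.prems by (intro insert.IH) auto
  obtain a p where xk: "x k = (of_real a, p)" and p: "p \<in> UHP"
    using insert.prems(1)[of k] by (auto elim: Reals_cases)
  have "fst (x k) \<noteq> fst (x j)" "\<beta> j \<noteq> 0" if "j \<in> J" for j
    using that inj_onD[OF insert.prems(2), of k j] insert.prems(3)[of j] insert.hyps by auto
  then have "isCont (\<lambda>z. \<Sum>j\<in>J. 1 / (of_real (\<beta> j) * (fst z - fst (x j)))) (x k)"
    by (intro continuous_intros) auto
  then have "point_mass G (x k) (1 / \<beta> k)"
    using point_mass_add[OF insert.prems(4)[of k] point_mass_isCont] by (simp add: G_def)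
  then have "pickfun (\<lambda>z. G z + of_real (1 / \<beta> k) / (fst z - of_real a))"
    using insert.prems(3)[of k] by (intro pickfun_remove_mass[OF G p]) (auto simp: xk)
  moreover have "(\<lambda>z. G z + of_real (1 / \<beta> k) / (fst z - of_real a)) =
    (\<lambda>z. F z + (\<Sum>j\<in>insert k J. 1 / (of_real (\<beta> j) * (fst z - fst (x j)))))"
    using insert.hyps by (simp add: G_def xk algebra_simps)
  ultimately show ?case by simp
qed

lemma rfun_swap:
  "rfun m n x y \<beta> \<gamma> (prod.swap z) = rfun n m (\<lambda>k. prod.swap (y k)) (\<lambda>j. prod.swap (x j)) \<gamma> \<beta> z"
  by (simp add: rfun_def add.commute)

text \<open>All summands of \<open>r\<close> but the \<open>i\<close>-th are continuous at \<open>x\<^sub>i\<close>: those in \<open>z\<^sup>1\<close> because the abscissae are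
distinct, those in \<open>z\<^sup>2\<close> because their poles are real and \<open>x\<^sub>i\<^sup>2\<close> is not.\<close>

lemma point_mass_rfun:
  assumes x: "\<And>j. j \<in> {1..m} \<Longrightarrow> x j \<in> \<real> \<times> UHP"
    and y: "\<And>k. k \<in> {1..n} \<Longrightarrow> y k \<in> UHP \<times> \<real>"
    and inj: "inj_on (\<lambda>j. fst (x j)) {1..m}"
    and \<beta>: "\<And>j. j \<in> {1..m} \<Longrightarrow> \<beta> j > 0"
    and \<gamma>: "\<And>k. k \<in> {1..n} \<Longrightarrow> \<gamma> k > 0"
    and i: "i \<in> {1..m}"
  shows "point_mass (rfun m n x y \<beta> \<gamma>) (x i) (- (1 / \<beta> i))"
proof -
  define G where "G = (\<lambda>z. (\<Sum>j\<in>{1..m} - {i}. 1 / (of_real (\<beta> j) * (fst z - fst (x j)))) +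
     (\<Sum>k=1..n. 1 / (of_real (\<gamma> k) * (snd z - snd (y k)))))"
  have "fst (x i) \<noteq> fst (x j)" "\<beta> j \<noteq> 0" if "j \<in> {1..m} - {i}" for j
    using that inj_onD[OF inj, of i j] i \<beta>[of j] by auto
  moreover have "snd (x i) \<noteq> snd (y k)" "\<gamma> k \<noteq> 0" if "k \<in> {1..n}" for k
    using x[OF i] y[OF that] \<gamma>[OF that] by (auto simp: UHP_def complex_is_Real_iff mem_Times_iff)
  ultimately have "isCont G (x i)"
    unfolding G_def by (intro continuous_intros) auto
  from point_mass_add[OF point_mass_pole[of "1 / \<beta> i" "x i"] point_mass_isCont[OF this]]
  have "point_mass (\<lambda>z. of_real (1 / \<beta> i) / (fst z - fst (x i)) + G z) (x i) (- (1 / \<beta> i))" by simp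
  moreover have "(\<lambda>z. of_real (1 / \<beta> i) / (fst z - fst (x i)) + G z) = rfun m n x y \<beta> \<gamma>"
    unfolding rfun_def G_def sum.remove[OF finite_atLeastAtMost i] by (simp add: add.assoc)
  ultimately show ?thesis by simp
qed

lemma point_mass_uminus: "point_mass F x c \<Longrightarrow> point_mass (\<lambda>z. - F z) x (- c)"
  unfolding point_mass_def by (drule tendsto_minus) simp

lemma pickfun_sum: "(\<And>j. j \<in> J \<Longrightarrow> pickfun (F j)) \<Longrightarrow> pickfun (\<lambda>z. \<Sum>j\<in>J. F j z)"
  by (induction J rule: infinite_finite_induct) (auto intro: pickfun_const pickfun_add)

lemma pickfun_poles:
  assumes x: "\<And>j. j \<in> J \<Longrightarrow> x j \<in> \<real> \<times> UHP" and \<beta>: "\<And>j. j \<in> J \<Longrightarrow> \<beta> j > 0"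
  shows "pickfun (\<lambda>z. \<Sum>j\<in>J. - (1 / (of_real (\<beta> j) * (fst z - fst (x j)))))"
proof (rule pickfun_sum)
  fix j assume j: "j \<in> J"
  obtain a where "fst (x j) = of_real a" using x[OF j] by (auto elim: Reals_cases)
  with pickfun_pole[of "1 / \<beta> j" a] \<beta>[OF j]
  show "pickfun (\<lambda>z. - (1 / (of_real (\<beta> j) * (fst z - fst (x j)))))" by simp
qed

context
  fixes m n :: nat and x y :: "nat \<Rightarrow> complex \<times> complex" and \<beta> \<gamma> :: "nat \<Rightarrow> real"
  assumes x: "\<And>j. j \<in> {1..m} \<Longrightarrow> x j \<in> \<real> \<times> UHP"
    and y: "\<And>k. k \<in> {1..n} \<Longrightarrow> y k \<in> UHP \<times> \<real>"
    and inj_x: "inj_on (\<lambda>j. fst (x j)) {1..m}"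
    and inj_y: "inj_on (\<lambda>k. snd (y k)) {1..n}"
    and \<beta>: "\<And>j. j \<in> {1..m} \<Longrightarrow> \<beta> j > 0"
    and \<gamma>: "\<And>k. k \<in> {1..n} \<Longrightarrow> \<gamma> k > 0"
begin

lemma swap_y: "k \<in> {1..n} \<Longrightarrow> prod.swap (y k) \<in> \<real> \<times> UHP"
  using y[of k] by (auto simp: mem_Times_iff)

lemma swap_x: "j \<in> {1..m} \<Longrightarrow> prod.swap (x j) \<in> UHP \<times> \<real>"
  using x[of j] by (auto simp: mem_Times_iff)

lemma point_mass_rfun_y:
  assumes "k \<in> {1..n}"
  shows "point_mass (\<lambda>z. rfun m n x y \<beta> \<gamma> (prod.swap z)) (prod.swap (y k)) (- (1 / \<gamma> k))"
  unfolding rfun_swap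
  by (rule point_mass_rfun[of n "\<lambda>k. prod.swap (y k)" m "\<lambda>j. prod.swap (x j)" \<gamma> \<beta>])
     (use swap_x swap_y inj_y \<beta> \<gamma> assms in auto)

lemma pickfun_uminus_rfun: "pickfun (\<lambda>z. - rfun m n x y \<beta> \<gamma> z)"
proof -
  have "pickfun (\<lambda>z. \<Sum>k=1..n. - (1 / (of_real (\<gamma> k) * (fst (prod.swap z) - fst (prod.swap (y k))))))"
    by (rule pickfun_swap[OF pickfun_poles]) (use swap_y \<gamma> in auto)
  from pickfun_add[OF pickfun_poles this, of "{1..m}" x \<beta>] x \<beta>
  show ?thesis by (simp add: rfun_def sum_negf)
qed

text \<open>The correspondence \<open>f = F + r\<close> between Pick functions with the prescribed masses and Pick functions
without mass at the given points. From left to right, the poles in \<open>z\<^sup>1\<close> are removed first; they do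
not affect the masses on the other facet.\<close>

lemma pickfun_mass_iff:
  "pickfun F \<and> (\<forall>j\<in>{1..m}. point_mass F (x j) (1 / \<beta> j)) \<and>
     (\<forall>k\<in>{1..n}. point_mass (\<lambda>z. F (prod.swap z)) (prod.swap (y k)) (1 / \<gamma> k)) \<longleftrightarrow>
   pickfun (\<lambda>z. F z + rfun m n x y \<beta> \<gamma> z) \<and>
     (\<forall>j\<in>{1..m}. point_mass (\<lambda>z. F z + rfun m n x y \<beta> \<gamma> z) (x j) 0) \<and>
     (\<forall>k\<in>{1..n}. point_mass (\<lambda>z. F (prod.swap z) + rfun m n x y \<beta> \<gamma> (prod.swap z)) (prod.swap (y k)) 0)"
  (is "?L \<longleftrightarrow> ?R")
proof
  define r where "r = rfun m n x y \<beta> \<gamma>"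
  have mass_x: "point_mass r (x j) (- (1 / \<beta> j))" if "j \<in> {1..m}" for j
    unfolding r_def by (rule point_mass_rfun[OF x y inj_x \<beta> \<gamma> that])
  note mass_y = point_mass_rfun_y[folded r_def]
  {
    assume ?L
    then have F: "pickfun F" and Fx: "\<And>j. j \<in> {1..m} \<Longrightarrow> point_mass F (x j) (1 / \<beta> j)"
      and Fy: "\<And>k. k \<in> {1..n} \<Longrightarrow> point_mass (\<lambda>z. F (prod.swap z)) (prod.swap (y k)) (1 / \<gamma> k)" by auto
    define r1 where "r1 = (\<lambda>z :: complex \<times> complex. \<Sum>j=1..m. 1 / (of_real (\<beta> j) * (fst z - fst (x j))))"
    have F1: "pickfun (\<lambda>z. F z + r1 z)"
      unfolding r1_def by (rule pickfun_remove_masses[OF F _ x inj_x \<beta> Fx]) auto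
    have "point_mass (\<lambda>z. F (prod.swap z) + r1 (prod.swap z)) (prod.swap (y k)) (1 / \<gamma> k)" if k: "k \<in> {1..n}" for k
    proof -
      have "fst (y k) \<noteq> fst (x j)" "\<beta> j \<noteq> 0" if "j \<in> {1..m}" for j
        using x[OF that] y[OF k] \<beta>[OF that] by (auto simp: UHP_def complex_is_Real_iff mem_Times_iff)
      then have "isCont (\<lambda>z. r1 (prod.swap z)) (prod.swap (y k))"
        unfolding r1_def fst_swap by (intro continuous_intros) auto
      from point_mass_add[OF Fy[OF k] point_mass_isCont[OF this]] show ?thesis by simp
    qed
    then have "pickfun (\<lambda>z. F (prod.swap z) + r1 (prod.swap z) +
        (\<Sum>k=1..n. 1 / (of_real (\<gamma> k) * (fst z - fst (prod.swap (y k))))))"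
      by (intro pickfun_remove_masses pickfun_swap[OF F1] swap_y \<gamma>) (use inj_y in auto)
    from pickfun_swap[OF this] have "pickfun (\<lambda>z. F z + r z)"
      by (simp add: r_def rfun_def r1_def add.assoc)
    moreover have "point_mass (\<lambda>z. F z + r z) (x j) 0" if "j \<in> {1..m}" for j
      using point_mass_add[OF Fx[OF that] mass_x[OF that]] by simp
    moreover have "point_mass (\<lambda>z. F (prod.swap z) + r (prod.swap z)) (prod.swap (y k)) 0" if "k \<in> {1..n}" for k
      using point_mass_add[OF Fy[OF that] mass_y[OF that]] by simp
    ultimately show ?R by (simp add: r_def)
  next
    assume R: ?R
    have "pickfun F" using pickfun_add[OF _ pickfun_uminus_rfun, of "\<lambda>z. F z + rfun m n x y \<beta> \<gamma> z"] R by simp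
    moreover have "point_mass F (x j) (1 / \<beta> j)" if "j \<in> {1..m}" for j
      using point_mass_add[OF _ point_mass_uminus[OF mass_x[OF that]], of "\<lambda>z. F z + r z" 0] R that
      by (simp add: r_def)
    moreover have "point_mass (\<lambda>z. F (prod.swap z)) (prod.swap (y k)) (1 / \<gamma> k)" if "k \<in> {1..n}" for k
      using point_mass_add[OF _ point_mass_uminus[OF mass_y[OF that]], of "\<lambda>z. F (prod.swap z) + r (prod.swap z)" 0] R that
      by (simp add: r_def)
    ultimately show ?L by blast
  }
qed

lemma solutions_iff_point_mass:
  fixes \<xi> :: real
  defines "F h z \<equiv> - 1 / (h z - of_real \<xi>)"
  shows "h \<in> solutions m n x y \<xi> \<beta> \<gamma> \<longleftrightarrow> h \<in> extensional UHP2 \<and> pickfun h \<and> pickfun (F h) \<and>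
     (\<forall>j\<in>{1..m}. point_mass (F h) (x j) (1 / \<beta> j)) \<and>
     (\<forall>k\<in>{1..n}. point_mass (\<lambda>z. F h (prod.swap z)) (prod.swap (y k)) (1 / \<gamma> k))"
proof -
  have sol: "h \<in> solutions m n x y \<xi> \<beta> \<gamma> \<longleftrightarrow> h \<in> extensional UHP2 \<and> pickfun h \<and>
     (\<forall>j\<in>{1..m}. facet_data h (x j) \<xi> (of_real (\<beta> j), 0)) \<and>
     (\<forall>k\<in>{1..n}. facet_data h (y k) \<xi> (0, of_real (\<gamma> k)))"
    unfolding solutions_def pick2_def pickfun_def facet_data_def by blast
  show ?thesis
  proof (cases "pickfun h")
    case True
    have "pickfun (\<lambda>z. h z + - of_real \<xi>)" by (intro pickfun_add True pickfun_const) simp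
    from pickfun_neg_inverse[OF this] have F: "pickfun (F h)" by (simp add: F_def[abs_def])
    have "facet_data h (x j) \<xi> (of_real (\<beta> j), 0) \<longleftrightarrow> point_mass (F h) (x j) (1 / \<beta> j)"
      if "j \<in> {1..m}" for j
      unfolding F_def[abs_def] by (intro facet_data_iff_point_mass True x \<beta> that)
    moreover have "facet_data h (y k) \<xi> (0, of_real (\<gamma> k)) \<longleftrightarrow>
        point_mass (\<lambda>z. F h (prod.swap z)) (prod.swap (y k)) (1 / \<gamma> k)" if "k \<in> {1..n}" for k
      unfolding F_def[abs_def] facet_data_swap[of h]
      by (intro facet_data_iff_point_mass pickfun_swap True swap_y \<gamma> that)
    ultimately show ?thesis unfolding sol using True F by simp
  qed (simp add: sol)
qed

text \<open>With \<open>F = - 1 / (h - \<xi>)\<close> and \<open>f = F + r\<close> one has \<open>r - f = 1 / (h - \<xi>)\<close>; the identity remains valid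
under \<open>1 / 0 = 0\<close> when \<open>h = \<xi>\<close>.\<close>

lemma solutions_eq:
  "solutions m n x y \<xi> \<beta> \<gamma> =
      {h. \<exists>f\<in>pick2.
         (\<forall>j\<in>{1..m}. ((\<lambda>t. of_real t * f (x j + t *\<^sub>R (\<i>, 0))) \<longlongrightarrow> 0) (at_right (0::real))) \<and>
         (\<forall>k\<in>{1..n}. ((\<lambda>t. of_real t * f (y k + t *\<^sub>R (0, \<i>))) \<longlongrightarrow> 0) (at_right (0::real))) \<and>
         h = (\<lambda>z\<in>UHP2. of_real \<xi> + 1 / (rfun m n x y \<beta> \<gamma> z - f z))}" (is "_ = ?R")
proof -
  define r where "r = rfun m n x y \<beta> \<gamma>"
  have limx: "((\<lambda>t. of_real t * f (x j + t *\<^sub>R (\<i>, 0))) \<longlongrightarrow> 0) (at_right (0::real)) \<longleftrightarrow> point_mass f (x j) 0" for f j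
    by (simp add: point_mass_def)
  have "prod.swap (prod.swap (y k) + t *\<^sub>R (\<i>, 0)) = y k + t *\<^sub>R (0, \<i>)" for k t
    by (simp add: prod_eq_iff)
  then have limy: "((\<lambda>t. of_real t * f (y k + t *\<^sub>R (0, \<i>))) \<longlongrightarrow> 0) (at_right (0::real)) \<longleftrightarrow>
      point_mass (\<lambda>z. f (prod.swap z)) (prod.swap (y k)) 0" for f k
    by (simp add: point_mass_def)
  have pick2: "f \<in> pick2 \<longleftrightarrow> f \<in> extensional UHP2 \<and> pickfun f" for f
    unfolding pick2_def pickfun_def by blast
  show ?thesis
  proof (intro equalityI subsetI)
    fix h assume "h \<in> solutions m n x y \<xi> \<beta> \<gamma>"
    note sol = this[unfolded solutions_iff_point_mass]
    have "pickfun (\<lambda>z. - 1 / (h z - of_real \<xi>) + r z) \<and>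
      (\<forall>j\<in>{1..m}. point_mass (\<lambda>z. - 1 / (h z - of_real \<xi>) + r z) (x j) 0) \<and>
      (\<forall>k\<in>{1..n}. point_mass (\<lambda>z. - 1 / (h (prod.swap z) - of_real \<xi>) + r (prod.swap z)) (prod.swap (y k)) 0)"
      unfolding r_def by (rule iffD1[OF pickfun_mass_iff]) (use sol in blast)
    then have P: "pickfun (\<lambda>z. - 1 / (h z - of_real \<xi>) + r z)"
      and Mx: "\<And>j. j \<in> {1..m} \<Longrightarrow> point_mass (\<lambda>z. - 1 / (h z - of_real \<xi>) + r z) (x j) 0"
      and My: "\<And>k. k \<in> {1..n} \<Longrightarrow> point_mass (\<lambda>z. - 1 / (h (prod.swap z) - of_real \<xi>) + r (prod.swap z)) (prod.swap (y k)) 0"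
      by blast+
    have h_ext: "h \<in> extensional UHP2" using sol by blast
    define f where "f = (\<lambda>z\<in>UHP2. - 1 / (h z - of_real \<xi>) + r z)"
    have f: "f z = - 1 / (h z - of_real \<xi>) + r z" if "z \<in> UHP2" for z using that by (simp add: f_def)
    have "pickfun f" by (rule pickfun_cong[OF P f[symmetric]])
    then have "f \<in> pick2" unfolding pick2 by (simp add: f_def)
    moreover have "point_mass f (x j) 0" if "j \<in> {1..m}" for j
      using Mx[OF that] by (subst point_mass_cong[OF x[OF that] f])
    moreover have "point_mass (\<lambda>z. f (prod.swap z)) (prod.swap (y k)) 0" if "k \<in> {1..n}" for k
      using My[OF that] by (subst point_mass_cong[OF swap_y[OF that] f]) auto
    moreover have "h = (\<lambda>z\<in>UHP2. of_real \<xi> + 1 / (r z - f z))"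
      using h_ext by (intro ext) (auto simp: f extensional_def)
    ultimately show "h \<in> ?R" unfolding limx limy r_def[symmetric] by blast
  next
    fix h assume "h \<in> ?R"
    then obtain f where f: "f \<in> pick2" and fx: "\<And>j. j \<in> {1..m} \<Longrightarrow> point_mass f (x j) 0"
      and fy: "\<And>k. k \<in> {1..n} \<Longrightarrow> point_mass (\<lambda>z. f (prod.swap z)) (prod.swap (y k)) 0"
      and h: "h = (\<lambda>z\<in>UHP2. of_real \<xi> + 1 / (r z - f z))"
      unfolding limx limy r_def by blast
    have eq: "- 1 / (h z - of_real \<xi>) = f z - r z" if "z \<in> UHP2" for z using that by (simp add: h)
    have fr: "f z = - 1 / (h z - of_real \<xi>) + r z" if "z \<in> UHP2" for z using eq[OF that] by simp
    have pf: "pickfun f" using f pick2 by blast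
    have Fr: "pickfun (\<lambda>z. - 1 / (h z - of_real \<xi>) + r z)" by (rule pickfun_cong[OF pf fr])
    have "pickfun (\<lambda>z. f z + - r z)" unfolding r_def by (intro pickfun_add pf pickfun_uminus_rfun)
    from pickfun_add[OF pickfun_const pickfun_neg_inverse[OF this], of "of_real \<xi>"]
    have Ph: "pickfun h"
      by (rule pickfun_cong) (simp_all add: h minus_divide_left[symmetric] minus_divide_right)
    have Mx: "point_mass (\<lambda>z. - 1 / (h z - of_real \<xi>) + r z) (x j) 0" if "j \<in> {1..m}" for j
      using fx[OF that] by (subst (asm) point_mass_cong[OF x[OF that] fr])
    have My: "point_mass (\<lambda>z. - 1 / (h (prod.swap z) - of_real \<xi>) + r (prod.swap z)) (prod.swap (y k)) 0"
      if "k \<in> {1..n}" for k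
      using fy[OF that] by (subst (asm) point_mass_cong[OF swap_y[OF that] fr]) auto
    have "pickfun (\<lambda>z. - 1 / (h z - of_real \<xi>)) \<and>
      (\<forall>j\<in>{1..m}. point_mass (\<lambda>z. - 1 / (h z - of_real \<xi>)) (x j) (1 / \<beta> j)) \<and>
      (\<forall>k\<in>{1..n}. point_mass (\<lambda>z. - 1 / (h (prod.swap z) - of_real \<xi>)) (prod.swap (y k)) (1 / \<gamma> k))"
      by (rule iffD2[OF pickfun_mass_iff]) (use Fr Mx My in \<open>unfold r_def, blast\<close>)
    moreover have "h \<in> extensional UHP2" by (simp add: h)
    ultimately show "h \<in> solutions m n x y \<xi> \<beta> \<gamma>"
      unfolding solutions_iff_point_mass using Ph by blast
  qed
qed

end

theorem theorem7p1:
  fixes m n :: nat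
    and x y :: "nat \<Rightarrow> complex \<times> complex"
    and \<xi> :: real
    and \<beta> \<gamma> :: "nat \<Rightarrow> real"
  assumes "\<And>j. j \<in> {1..m} \<Longrightarrow> x j \<in> \<real> \<times> UHP"
    and "\<And>k. k \<in> {1..n} \<Longrightarrow> y k \<in> UHP \<times> \<real>"
    and "inj_on (\<lambda>j. fst (x j)) {1..m}"
    and "inj_on (\<lambda>k. snd (y k)) {1..n}"
    and "\<And>j. j \<in> {1..m} \<Longrightarrow> \<beta> j > 0"
    and "\<And>k. k \<in> {1..n} \<Longrightarrow> \<gamma> k > 0"
  shows "infinite (solutions m n x y \<xi> \<beta> \<gamma>) \<and>
    solutions m n x y \<xi> \<beta> \<gamma> =
      {h. \<exists>f\<in>pick2.
         (\<forall>j\<in>{1..m}. ((\<lambda>t. of_real t * f (x j + t *\<^sub>R (\<i>, 0))) \<longlongrightarrow> 0) (at_right (0::real))) \<and>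
         (\<forall>k\<in>{1..n}. ((\<lambda>t. of_real t * f (y k + t *\<^sub>R (0, \<i>))) \<longlongrightarrow> 0) (at_right (0::real))) \<and>
         h = (\<lambda>z\<in>UHP2. of_real \<xi> + 1 / (rfun m n x y \<beta> \<gamma> z - f z))} \<and>
    (\<forall>c::real. (\<lambda>z\<in>UHP2. of_real \<xi> + 1 / (rfun m n x y \<beta> \<gamma> z - of_real c))
       \<in> solutions m n x y \<xi> \<beta> \<gamma>)"
proof -
  define H where "H = (\<lambda>c::real. \<lambda>z\<in>UHP2. of_real \<xi> + 1 / (rfun m n x y \<beta> \<gamma> z - of_real c))"
  have eq: "solutions m n x y \<xi> \<beta> \<gamma> =
      {h. \<exists>f\<in>pick2.
         (\<forall>j\<in>{1..m}. ((\<lambda>t. of_real t * f (x j + t *\<^sub>R (\<i>, 0))) \<longlongrightarrow> 0) (at_right (0::real))) \<and>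
         (\<forall>k\<in>{1..n}. ((\<lambda>t. of_real t * f (y k + t *\<^sub>R (0, \<i>))) \<longlongrightarrow> 0) (at_right (0::real))) \<and>
         h = (\<lambda>z\<in>UHP2. of_real \<xi> + 1 / (rfun m n x y \<beta> \<gamma> z - f z))}"
    by (rule solutions_eq[OF assms])
  have sol: "H c \<in> solutions m n x y \<xi> \<beta> \<gamma>" for c
  proof -
    define f :: "complex \<times> complex \<Rightarrow> complex" where "f = (\<lambda>z\<in>UHP2. of_real c)"
    have "pickfun f" by (rule pickfun_cong[OF pickfun_const[of "of_real c"]]) (auto simp: f_def)
    then have "f \<in> pick2" by (simp add: pick2_def pickfun_def f_def)
    have mass: "((\<lambda>t. of_real t * f (g t)) \<longlongrightarrow> 0) (at_right (0::real))"
      if "\<And>t. t > 0 \<Longrightarrow> g t \<in> UHP2" for g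
    proof -
      have "((\<lambda>t::real. of_real t * complex_of_real c) \<longlongrightarrow> 0) (at_right 0)"
        by (auto intro!: tendsto_eq_intros)
      then show ?thesis
        by (rule Lim_transform_eventually)
           (rule eventually_at_rightI[of 0 1], auto simp: f_def that)
    qed
    have "x j + t *\<^sub>R (\<i>, 0) \<in> UHP2" if "j \<in> {1..m}" "t > 0" for j t
      using assms(1)[OF that(1)] that(2) by (cases "x j") (auto simp: UHP_def complex_is_Real_iff)
    moreover have "y k + t *\<^sub>R (0, \<i>) \<in> UHP2" if "k \<in> {1..n}" "t > 0" for k t
      using assms(2)[OF that(1)] that(2) by (cases "y k") (auto simp: UHP_def complex_is_Real_iff)
    moreover have "H c = (\<lambda>z\<in>UHP2. of_real \<xi> + 1 / (rfun m n x y \<beta> \<gamma> z - f z))"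
      by (auto simp: H_def f_def)
    ultimately show ?thesis
      unfolding eq by (intro CollectI bexI[OF _ \<open>f \<in> pick2\<close>] conjI ballI mass)
  qed
  \<comment> \<open>The map \<open>u \<mapsto> 1 / (r - u)\<close> is injective, also where the denominator vanishes.\<close>
  have "inj H"
  proof (rule injI)
    fix c d assume "H c = H d"
    then have "H c (\<i>, \<i>) = H d (\<i>, \<i>)" by simp
    then show "c = d" by (simp add: H_def divide_inverse)
  qed
  then have "infinite (range H)" by (simp add: finite_image_iff infinite_UNIV_char_0)
  then have "infinite (solutions m n x y \<xi> \<beta> \<gamma>)"
    using sol by (meson finite_subset image_subsetI)
  with eq sol show ?thesis unfolding H_def by blast
qed

end
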